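(* Let $p\in\mathbb{C}$ with $\Re(p)>0$, let $\nu>0$, let $\kappa,\mu$ be real with $\mu\pm\kappa+\frac12>0$, and let $z\in\mathbb{C}\setminus\{0\}$ with $-\pi<\arg z\le\pi$. Then $$|M_{\kappa,\mu}^{(p,\nu)}(z)|<C\,|z|^{\mu+\frac12}e^{-\Re(z)/2}\,\frac{B(\mu-\kappa+\nu+\frac12,\,\mu+\kappa+\nu+\frac12)}{B(\mu-\kappa+\frac12,\,\mu+\kappa+\frac12)}\,\Phi\left(\mu-\kappa+\nu+\tfrac12;\,2\mu+2\nu+1;\,\Re(z)\right),$$ where $$C=\frac{2^\nu|p|^{\nu+1}\,\Gamma(\nu+\frac12)}{\sqrt{\pi}\,(\Re(p))^{2\nu+1}}.$$
   Context: $B(x,y)=\Gamma(x)\Gamma(y)/\Gamma(x+y)$ is the Beta function, $K_\lambda$ is the modified Bessel function of the second kind, and $\Phi(b;c;z)=\sum_{n=0}^\infty\frac{(b)_n}{(c)_n}\frac{z^n}{n!}$ is the ordinary confluent hypergeometric function, with $(a)_n=\Gamma(a+n)/\Gamma(a)$. Complex powers of $z$ are principal. For $\Re(p)>0$, $\nu\ge 0$, the extended Beta function is $$B_{p,\nu}(x,y)=\sqrt{\frac{2p}{\pi}}\int_0^1 t^{x-\frac32}(1-t)^{y-\frac32}K_{\nu+\frac12}\left(\frac{p}{t(1-t)}\right)dt.$$ The $(p,\nu)$-extended confluent hypergeometric function is $$\Phi_{p,\nu}(b;c;z)=\sum_{m=0}^\infty\frac{B_{p,\nu}(b+m,c-b)}{B(b,c-b)}\frac{z^m}{m!}=\frac{1}{B(b,c-b)}\sqrt{\frac{2p}{\pi}}\int_0^1t^{b-\frac32}(1-t)^{c-b-\frac32}e^{zt}K_{\nu+\frac12}\left(\frac{p}{t(1-t)}\right)dt.$$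 The $(p,\nu)$-extended Whittaker function is $$M_{\kappa,\mu}^{(p,\nu)}(z)=z^{\mu+\frac12}e^{-z/2}\,\Phi_{p,\nu}(\mu-\kappa+\tfrac12;2\mu+1;z).$$ *)

theory Defs
  imports "HOL-Analysis.Analysis"
begin

definition besselI :: "real \<Rightarrow> complex \<Rightarrow> complex" where
  "besselI l z = (z / 2) powr of_real l *
     (\<Sum>k. rGamma (of_real l + of_nat k + 1) * (z / 2) ^ (2 * k) / fact k)"

(* Modified Bessel function of the second kind, of real order: the quotient below at
   non-integer order, and its limiting value with respect to the order at integer order. *)

definition besselK_quot :: "real \<Rightarrow> complex \<Rightarrow> complex" where
  "besselK_quot l z = of_real pi / 2 * (besselI (- l) z - besselI l z) / of_real (sin (l * pi))"

definition besselK :: "real \<Rightarrow> complex \<Rightarrow> complex" where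
  "besselK l z =
     (if l \<in> \<int> then Lim (at l) (\<lambda>s. besselK_quot s z) else besselK_quot l z)"

definition conf_hyp :: "'a \<Rightarrow> 'a \<Rightarrow> 'a \<Rightarrow> 'a::{real_normed_field,banach}" where
  "conf_hyp b c z = (\<Sum>n. pochhammer b n / pochhammer c n * z ^ n / fact n)"

definition ext_Beta :: "complex \<Rightarrow> real \<Rightarrow> complex \<Rightarrow> complex \<Rightarrow> complex" where
  "ext_Beta p \<nu> x y = csqrt (2 * p / of_real pi) *
     (LINT t:{0<..<1}|lborel.
        of_real t powr (x - 3 / 2) * of_real (1 - t) powr (y - 3 / 2) *
        besselK (\<nu> + 1 / 2) (p / of_real (t * (1 - t))))"

definition ext_conf_hyp :: "complex \<Rightarrow> real \<Rightarrow> complex \<Rightarrow> complex \<Rightarrow> complex \<Rightarrow> complex" where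
  "ext_conf_hyp p \<nu> b c z =
     (\<Sum>m. ext_Beta p \<nu> (b + of_nat m) (c - b) / Beta b (c - b) * z ^ m / fact m)"

definition ext_Whittaker_M ::
    "complex \<Rightarrow> real \<Rightarrow> complex \<Rightarrow> complex \<Rightarrow> complex \<Rightarrow> complex" where
  "ext_Whittaker_M p \<nu> \<kappa> \<mu> z =
     z powr (\<mu> + 1 / 2) * exp (- z / 2) *
     ext_conf_hyp p \<nu> (\<mu> - \<kappa> + 1 / 2) (2 * \<mu> + 1) z"

end

theory Submission
  imports Defs "HOL-Real_Asymp.Real_Asymp"
begin

text \<open>
  The heart of the matter is the integral representation
  $K_\lambda(w) = \frac12 \int_{-\infty}^{\infty} e^{\lambda u - w \cosh u}\,du$ for
  $\mathrm{Re}\, w > 0$, which gives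
  $|K_\lambda(w)| \le K_\lambda(\mathrm{Re}\, w) < \frac12 \Gamma(\lambda) (2 / \mathrm{Re}\, w)^\lambda$
  because $\cosh u > e^u / 2$. Inserting $w = p / (t (1 - t))$ with $\lambda = \nu + \frac12$
  turns the integrand of the extended function into that of the ordinary one with both
  Beta parameters shifted by $\nu$; the resulting constant is sharper than the stated one by
  the factor $(\mathrm{Re}\, p / |p|)^{\nu + 1/2} \le 1$.

  To match the integral $H_\lambda$ with the quotient of the series $I_{\pm\lambda}$ for
  $0 < \lambda < 1$, one evaluates the constants
  $w (I_\lambda H_{\lambda - 1} + I_{\lambda - 1} H_\lambda) = 1$ and
  $w (I_{\lambda - 1} I_{-\lambda} - I_\lambda I_{1 - \lambda}) = 2 \sin(\pi\lambda) / \pi$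
  as $w \to 0^+$. The first one, used for $\lambda$ and for $1 - \lambda$, is a linear system for
  $H_\lambda$ and $H_{\lambda - 1}$. The three-term recurrence extends the identity to all
  non-integer orders, and continuity in the order to integer ones.
\<close>

section \<open>An integral representation of the modified Bessel function\<close>

lemma set_integral_lborel_of_has_integral_nonneg:
  fixes f :: "real \<Rightarrow> real"
  assumes "(f has_integral I) S" "\<And>x. x \<in> S \<Longrightarrow> f x \<ge> 0" "f \<in> borel_measurable borel" "S \<in> sets borel"
  shows "set_integrable lborel S f" "(LINT x:S|lborel. f x) = I"
proof -
  \<comment> \<open>A nonnegative gauge-integrable function is absolutely integrable; Borel
    measurability then brings the integral from the completed measure down to
    \<open>lborel\<close>.\<close>
  have "f absolutely_integrable_on S"
    using assms by (subst absolutely_integrable_on_iff_nonneg) auto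
  then show si: "set_integrable lborel S f"
    using assms unfolding set_integrable_def
    by (subst (asm) integrable_completion) auto
  show "(LINT x:S|lborel. f x) = I"
    using set_borel_integral_eq_integral(2)[OF si] assms(1) by (simp add: integral_unique)
qed

text \<open>Substitution \<open>t = exp u\<close> in Euler's integral: the Jacobian
  \<open>exp u\<close> raises the exponent from \<open>a - 1\<close> to \<open>a\<close>.\<close>

lemma Gamma_integral_exp_substitution:
  assumes "a > (0::real)"
  shows "integrable lborel (\<lambda>u. exp (a * u - exp u))" "(LINT u|lborel. exp (a * u - exp u)) = Gamma a"
proof -
  \<comment> \<open>The point 0 is dropped so that the domain is exactly the range of
    \<open>exp\<close>.\<close>
  have "((\<lambda>t. t powr (a - 1) / exp t) has_integral Gamma a) {0<..}"
    using Gamma_integral_real[OF assms]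
    by (rule has_integral_spike_set_eq[THEN iffD1, rotated 2])
       (rule negligible_subset[of "{0}"]; auto)+
  moreover have "(\<lambda>t. t powr (a - 1) / exp t) absolutely_integrable_on {0<..}"
    using calculation by (subst absolutely_integrable_on_iff_nonneg) auto
  moreover have "range (exp :: real \<Rightarrow> real) = {0<..}"
    by (auto simp: image_iff intro: exp_ln[symmetric])
  ultimately have "(\<lambda>x. \<bar>exp x\<bar> * (exp x powr (a - 1) / exp (exp x))) absolutely_integrable_on UNIV \<and>
     integral UNIV (\<lambda>x. \<bar>exp x\<bar> * (exp x powr (a - 1) / exp (exp x))) = Gamma a"
    by (subst has_absolute_integral_change_of_variables_1'[where g = exp])
       (auto intro!: derivative_eq_intros simp: inj_on_def integral_unique)
  moreover have "\<bar>exp x\<bar> * (exp x powr (a - 1) / exp (exp x)) = exp (a * x - exp x)" for x :: real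
    by (simp add: powr_def exp_diff algebra_simps)
  ultimately have "((\<lambda>x. exp (a * x - exp x)) has_integral Gamma a) UNIV"
    by (simp add: has_integral_iff absolutely_integrable_on_def)
  from set_integral_lborel_of_has_integral_nonneg[OF this]
  show "integrable lborel (\<lambda>u. exp (a * u - exp u))" "(LINT u|lborel. exp (a * u - exp u)) = Gamma a"
    by (auto simp: set_integrable_def set_lebesgue_integral_def)
qed

text \<open>The scale \<open>x\<close> is absorbed by translating \<open>u\<close> by
  \<open>ln x\<close>.\<close>

lemma Gamma_integral_exp_substitution_scaled:
  assumes "a > (0::real)" "x > 0"
  shows "integrable lborel (\<lambda>u. exp (a * u - x * exp u))"
    "(LINT u|lborel. exp (a * u - x * exp u)) = Gamma a / x powr a"
proof -
  have eq: "exp (a * u - x * exp u) = x powr (- a) * exp (a * (ln x + 1 * u) - exp (ln x + 1 * u))" for u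
    using assms by (simp add: powr_def exp_add algebra_simps flip: exp_add) (simp add: exp_add)
  show "integrable lborel (\<lambda>u. exp (a * u - x * exp u))"
    unfolding eq
    by (intro integrable_mult_right lborel_integrable_real_affine[where f = "\<lambda>u. exp (a * u - exp u)"]
        Gamma_integral_exp_substitution assms) auto
  show "(LINT u|lborel. exp (a * u - x * exp u)) = Gamma a / x powr a"
    unfolding eq
    using lborel_integral_real_affine[of 1 "\<lambda>u. exp (a * u - exp u)" "ln x"] 
      Gamma_integral_exp_substitution[OF assms(1)]
    by (simp add: powr_minus divide_simps)
qed

lemma integrable_lborel_uminus_iff:
  fixes f :: "real \<Rightarrow> 'a :: {banach, second_countable_topology}"
  shows "integrable lborel (\<lambda>u. f (- u)) \<longleftrightarrow> integrable lborel f"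
  using lborel_integrable_real_affine_iff[of "-1" f 0] by simp

lemma integral_lborel_uminus:
  fixes f :: "real \<Rightarrow> 'a :: {banach, second_countable_topology}"
  shows "(LINT u|lborel. f (- u)) = (LINT u|lborel. f u)"
  using lborel_integral_real_affine[of "-1" f 0] by simp

lemma cosh_ge_half_exp: "cosh u \<ge> exp u / 2" for u :: real
  by (simp add: cosh_field_def)

text \<open>Since \<open>cosh u\<close> is at least \<open>exp u / 2\<close> and at least
  \<open>exp (- u) / 2\<close>, the integrand lies below a Gamma integrand for one sign of
  \<open>u\<close> and below its mirror image for the other.\<close>

lemma integrable_exp_cosh:
  assumes "x > (0::real)"
  shows "integrable lborel (\<lambda>u. exp (a * u - x * cosh u))"
proof -
  \<comment> \<open>The exponent must dominate both \<open>a\<close> and \<open>- a\<close> and be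
    positive; the summand 1 covers \<open>a = 0\<close>.\<close>
  define b where "b = \<bar>a\<bar> + 1"
  have b: "integrable lborel (\<lambda>u. exp (b * u - x / 2 * exp u))"
    using assms by (intro Gamma_integral_exp_substitution_scaled) (auto simp: b_def)
  then have b': "integrable lborel (\<lambda>u. exp (b * (-u) - x / 2 * exp (-u)))"
    by (subst integrable_lborel_uminus_iff)
  show ?thesis
  proof (rule Bochner_Integration.integrable_bound[OF Bochner_Integration.integrable_add[OF b b']])
    show "AE u in lborel. norm (exp (a * u - x * cosh u)) \<le>
        norm (exp (b * u - x / 2 * exp u) + exp (b * (-u) - x / 2 * exp (-u)))"
    proof (rule AE_I2)
      fix u :: real
      have c: "x * cosh u \<ge> x / 2 * exp u" "x * cosh u \<ge> x / 2 * exp (-u)"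
        using mult_left_mono[OF cosh_ge_half_exp[of u], of x] mult_left_mono[OF cosh_ge_half_exp[of "-u"], of x]
        using assms by auto
      have "a * u \<le> b * u \<or> a * u \<le> b * (-u)"
      proof (cases "u \<ge> 0")
        case True then show ?thesis by (intro disjI1 mult_right_mono) (auto simp: b_def)
      next
        case False
        then have "a * u \<le> (- b) * u" by (intro mult_right_mono_neg) (auto simp: b_def)
        then show ?thesis by simp
      qed
      then have "exp (a * u - x * cosh u) \<le> exp (b * u - x / 2 * exp u) \<or>
            exp (a * u - x * cosh u) \<le> exp (b * (-u) - x / 2 * exp (-u))"
        unfolding exp_le_cancel_iff using c by linarith
      then show "norm (exp (a * u - x * cosh u)) \<le>
        norm (exp (b * u - x / 2 * exp u) + exp (b * (-u) - x / 2 * exp (-u)))"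
        by (smt (verit) exp_gt_zero real_norm_def)
    qed
  qed (auto simp: cosh_field_def)
qed

text \<open>A nonnegative difference with integral 0 vanishes almost everywhere, which an interval
  of positive length rules out. This keeps the estimates strict, both in the integral over
  \<open>u\<close> and later in the one over \<open>t\<close>.\<close>

lemma integral_strict_mono_lborel:
  fixes f g :: "real \<Rightarrow> real"
  assumes "integrable lborel f" "integrable lborel g" "\<And>x. f x \<le> g x"
    and "a < b" "\<And>x. x \<in> {a<..<b} \<Longrightarrow> f x < g x"
  shows "(LINT x|lborel. f x) < (LINT x|lborel. g x)"
proof -
  have int: "integrable lborel (\<lambda>x. g x - f x)" using assms by auto
  have "(LINT x|lborel. g x - f x) \<noteq> 0"
  proof
    assume "(LINT x|lborel. g x - f x) = 0"
    then have "AE x in lborel. g x - f x = 0"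
      using assms(3) by (subst (asm) integral_nonneg_eq_0_iff_AE[OF int]) auto
    then have "AE x in lborel. x \<notin> {a<..<b}"
      by eventually_elim (use assms(5) in force)
    then have "emeasure lborel {a<..<b} = 0"
      by (subst (asm) AE_iff_measurable[where N = "{a<..<b}"]) auto
    then show False using \<open>a < b\<close> by simp
  qed
  moreover have "(LINT x|lborel. g x - f x) \<ge> 0"
    using assms(3) by (intro Bochner_Integration.integral_nonneg) auto
  ultimately show ?thesis using assms(1,2) by simp
qed

section \<open>The integral \<open>besselH\<close>: bound, recurrence, derivative and limits\<close>

definition besselH :: "real \<Rightarrow> complex \<Rightarrow> complex" where
  "besselH l w = (LINT u|lborel. exp (of_real (l * u) - w * of_real (cosh u))) / 2"

lemma norm_exp_cosh: "norm (exp (of_real (a * u) - w * of_real (cosh u))) = exp (a * u - Re w * cosh u)"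
  by simp

lemma integrable_exp_cosh_complex:
  assumes "Re w > 0"
  shows "integrable lborel (\<lambda>u. exp (of_real (a * u) - w * of_real (cosh u)))"
proof (rule Bochner_Integration.integrable_bound[OF integrable_exp_cosh[of "Re w" a]])
  show "(\<lambda>u. exp (of_real (a * u) - w * of_real (cosh u))) \<in> borel_measurable lborel"
    unfolding cosh_field_def by measurable
qed (use assms in auto)

lemma besselH_minus: "besselH (- l) w = besselH l w"
  unfolding besselH_def
  using integral_lborel_uminus[of "\<lambda>u. exp (of_real (l * u) - w * of_real (cosh u))"] by simp

text \<open>Passing to norms replaces \<open>w\<close> by \<open>Re w\<close>. Dropping the part
  \<open>exp (- u) / 2\<close> of \<open>cosh u\<close> then loses strictly and leaves a Gamma
  integral of scale \<open>Re w / 2\<close>.\<close>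

lemma norm_besselH_less:
  assumes "Re w > 0" "l > 0"
  shows "norm (besselH l w) < Gamma l / 2 * (2 / Re w) powr l"
proof -
  have "norm (LINT u|lborel. exp (of_real (l * u) - w * of_real (cosh u))) \<le>
     (LINT u|lborel. norm (exp (of_real (l * u) - w * of_real (cosh u))))"
    by (rule integral_norm_bound)
  also have "\<dots> = (LINT u|lborel. exp (l * u - Re w * cosh u))"
    by (simp only: norm_exp_cosh)
  also have "\<dots> < (LINT u|lborel. exp (l * u - Re w / 2 * exp u))"
  proof (rule integral_strict_mono_lborel[where a = 0 and b = 1])
    show "integrable lborel (\<lambda>u. exp (l * u - Re w * cosh u))" using assms by (intro integrable_exp_cosh)
    show "integrable lborel (\<lambda>u. exp (l * u - Re w / 2 * exp u))"
      using assms by (intro Gamma_integral_exp_substitution_scaled) auto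
    show "exp (l * u - Re w * cosh u) < exp (l * u - Re w / 2 * exp u)" for u
      using assms by (auto simp: cosh_field_def field_simps)
    then show "exp (l * u - Re w * cosh u) \<le> exp (l * u - Re w / 2 * exp u)" for u
      by (rule less_imp_le)
  qed simp
  also have "\<dots> = Gamma l * (2 / Re w) powr l"
    using assms by (subst Gamma_integral_exp_substitution_scaled) (auto simp: powr_divide)
  finally show ?thesis by (simp add: besselH_def norm_divide)
qed

text \<open>The difference of the two sides is, up to a factor 2, the integral of the
  \<open>u\<close>-derivative of the integrand of order \<open>l\<close>. It is 0 because that
  integrand decays at both ends.\<close>

lemma besselH_recurrence:
  assumes "Re w > 0"
  shows "of_real l * besselH l w = w / 2 * (besselH (l + 1) w - besselH (l - 1) w)"
proof -
  define F where "F = (\<lambda>l u. exp (of_real (l * u) - w * of_real (cosh u)))"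
  have int: "integrable lborel (F l)" for l
    unfolding F_def by (rule integrable_exp_cosh_complex[OF assms])
  define f where "f = (\<lambda>u. of_real l * F l u - w / 2 * (F (l + 1) u - F (l - 1) u))"
  have intf: "integrable lborel f"
    unfolding f_def by (intro Bochner_Integration.integrable_diff integrable_mult_right int)
  have cosh: "complex_of_real (cosh u) = (exp (of_real u) + exp (- of_real u)) / 2" for u
    by (simp add: cosh_field_def flip: exp_of_real)
  have der: "(F l has_vector_derivative f u) (at u)" for u
  proof -
    have 1: "((\<lambda>u. exp (of_real l * u - w * ((exp u + exp (- u)) / 2))) has_field_derivative 
       exp (of_real l * of_real u - w * ((exp (of_real u) + exp (- of_real u)) / 2)) * 
        (of_real l - w * (exp (of_real u) - exp (- of_real u)) / 2)) (at (complex_of_real u))"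
      by (auto intro!: derivative_eq_intros simp: divide_simps)
    have 2: "F l = (\<lambda>u. exp (of_real l * u - w * ((exp u + exp (- u)) / 2))) \<circ> of_real"
      by (auto simp: F_def cosh)
    have 3: "exp (of_real l * of_real u - w * ((exp (of_real u) + exp (- of_real u)) / 2)) * 
        (of_real l - w * (exp (of_real u) - exp (- of_real u)) / 2) = f u"
    proof -
      have "F (l + 1) u = F l u * exp (of_real u)" "F (l - 1) u = F l u * exp (- of_real u)"
        by (simp_all add: F_def algebra_simps flip: exp_add)
      then have "f u = F l u * (of_real l - w * (exp (of_real u) - exp (- of_real u)) / 2)"
        unfolding f_def by (simp add: field_simps)
      then show ?thesis by (simp add: F_def cosh)
    qed
    show ?thesis
      unfolding 2 3[symmetric] o_def by (rule has_vector_derivative_real_field[OF 1])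
  qed
  have "(LBINT u=-\<infinity>..\<infinity>. f u) = 0 - 0"
  proof (rule interval_integral_FTC_integrable)
    have "((\<lambda>u. exp (l * u - Re w * ((exp u + exp (-u)) / 2))) \<longlongrightarrow> 0) at_top"
      using assms by real_asymp
    moreover have "((\<lambda>u. exp (l * u - Re w * ((exp u + exp (-u)) / 2))) \<longlongrightarrow> 0) at_bot"
      using assms by real_asymp
    ultimately have "(F l \<longlongrightarrow> 0) at_top" "(F l \<longlongrightarrow> 0) at_bot"
      by (auto simp: F_def cosh_field_def intro: Lim_null_comparison[rotated])
    then show "((F l \<circ> real_of_ereal) \<longlongrightarrow> 0) (at_right (-\<infinity>))" "((F l \<circ> real_of_ereal) \<longlongrightarrow> 0) (at_left \<infinity>)"
      by (auto simp: ereal_tendsto_simps)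
    show "isCont f u" for u
      unfolding f_def F_def cosh by (intro continuous_intros) auto
    show "set_integrable lborel (einterval (-\<infinity>) \<infinity>) f"
      using intf by (simp add: set_integrable_def)
  qed (use der in auto)
  then have "(LINT u|lborel. f u) = 0"
    by (simp add: interval_lebesgue_integral_def set_lebesgue_integral_def)
  then have "of_real l * (LINT u|lborel. F l u) = w / 2 * ((LINT u|lborel. F (l + 1) u) - (LINT u|lborel. F (l - 1) u))"
    unfolding f_def using int by simp
  then show ?thesis by (simp add: besselH_def F_def)
qed

text \<open>Differentiating the integrand in \<open>w\<close> brings down \<open>- cosh u\<close>;
  this expresses the result through the neighbouring orders.\<close>

lemma exp_times_cosh:
  "exp (of_real (l * u) - w * of_real (cosh u)) * of_real (cosh u) =
   (exp (of_real ((l + 1) * u) - w * of_real (cosh u)) + exp (of_real ((l - 1) * u) - w * of_real (cosh u))) / (2::complex)"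
proof -
  have 1: "complex_of_real (cosh u) = (exp (of_real u) + exp (- of_real u)) / 2"
    by (simp add: cosh_field_def flip: exp_of_real)
  have "exp (of_real ((l + 1) * u) - w * of_real (cosh u)) = exp (of_real (l * u) - w * of_real (cosh u)) * exp (of_real u)"
    "exp (of_real ((l - 1) * u) - w * of_real (cosh u)) = exp (of_real (l * u) - w * of_real (cosh u)) * exp (- complex_of_real u)"
    by (simp_all add: algebra_simps flip: exp_add)
  then show ?thesis by (subst 1) (simp add: algebra_simps)
qed

text \<open>Supplies the constant in the error bound for difference quotients of
  \<open>besselH\<close>. Expanding the square of \<open>cosh\<close> shifts the order by 2, 0 and
  -2.\<close>

lemma integrable_cosh_sq_exp:
  assumes "x > (0::real)"
  shows "integrable lborel (\<lambda>u. (cosh u)\<^sup>2 * exp (l * u - x * cosh u))"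
proof -
  have eq: "(cosh u)\<^sup>2 * exp (l * u - x * cosh u) =
     (exp ((l + 2) * u - x * cosh u) + 2 * exp (l * u - x * cosh u) + exp ((l - 2) * u - x * cosh u)) / 4" for u
  proof -
    have 1: "exp ((l + 2) * u - x * cosh u) = exp (l * u - x * cosh u) * (exp u)\<^sup>2"
      "exp ((l - 2) * u - x * cosh u) = exp (l * u - x * cosh u) * (exp (-u))\<^sup>2"
      by (simp_all add: algebra_simps power2_eq_square flip: exp_add)
    have "(cosh u)\<^sup>2 = ((exp u)\<^sup>2 + 2 * (exp u * exp (- u)) + (exp (-u))\<^sup>2) / 4"
      by (simp only: cosh_field_def) (simp add: power2_eq_square field_simps)
    then have 2: "(cosh u)\<^sup>2 = ((exp u)\<^sup>2 + 2 + (exp (-u))\<^sup>2) / 4"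
      by (simp flip: exp_add)
    show ?thesis unfolding 1 2 by (simp add: field_simps)
  qed
  show ?thesis unfolding eq
    by (intro integrable_divide_zero Bochner_Integration.integrable_add integrable_mult_right integrable_exp_cosh assms impI)
qed

text \<open>Differentiation under the integral by a quantitative estimate: \<open>G\<close> is the
  first-order Taylor remainder of the integrand in \<open>h\<close>. For
  \<open>norm h < x / 2\<close> at least half of the decay survives the factor
  \<open>exp (\<bar>Re h\<bar> * cosh u)\<close>, so the remainder integrates to at most
  \<open>K\<close> times the square of \<open>norm h\<close>.\<close>

lemma besselH_has_field_derivative:
  assumes "Re w > 0"
  shows "(besselH l has_field_derivative - (besselH (l + 1) w + besselH (l - 1) w) / 2) (at w)"
proof -
  define x where "x = Re w"
  have x: "x > 0" using assms by (simp add: x_def)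
  define F where "F = (\<lambda>l w u. exp (of_real (l * u) - w * of_real (cosh u)) :: complex)"
  have int: "integrable lborel (F l v)" if "Re v > 0" for l v
    unfolding F_def by (rule integrable_exp_cosh_complex[OF that])
  have H: "besselH l v = (LINT u|lborel. F l v u) / 2" for l v
    by (simp add: besselH_def F_def)
  define K where "K = (LINT u|lborel. (cosh u)\<^sup>2 * exp (l * u - x / 2 * cosh u))"
  have bound: "norm ((besselH l (w + h) - besselH l w) / h - - (besselH (l + 1) w + besselH (l - 1) w) / 2) \<le> K / 2 * norm h"
    if h: "norm h < x / 2" "h \<noteq> 0" for h
  proof -
    have "\<bar>Re h\<bar> < x / 2" using h abs_Re_le_cmod[of h] by linarith
    then have wh: "Re (w + h) > 0" using x by (simp add: x_def)
    define G where "G = (\<lambda>u. F l (w + h) u - F l w u + h * ((F (l + 1) w u + F (l - 1) w u) / 2))"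
    have intG: "integrable lborel G"
      unfolding G_def using int assms wh by auto
    have "norm (G u) \<le> (norm h)\<^sup>2 * ((cosh u)\<^sup>2 * exp (l * u - x / 2 * cosh u))" for u
    proof -
      let ?c = "complex_of_real (cosh u)"
      have "G u = F l (w + h) u - F l w u + h * (F l w u * ?c)"
        unfolding G_def F_def exp_times_cosh by simp
      also have "F l (w + h) u = F l w u * exp (- h * ?c)"
        by (simp add: F_def algebra_simps flip: exp_add)
      also have "\<dots> - F l w u + h * (F l w u * ?c) = F l w u * (exp (- h * ?c) - (\<Sum>k\<le>1. (- h * ?c) ^ k / fact k))"
        by (simp add: algebra_simps)
      finally have "norm (G u) = exp (l * u - x * cosh u) * norm (exp (- h * ?c) - (\<Sum>k\<le>1. (- h * ?c) ^ k / fact k))"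
        by (simp add: F_def norm_mult x_def)
      also have "\<dots> \<le> exp (l * u - x * cosh u) * (exp \<bar>Re (- h * ?c)\<bar> * norm (- h * ?c) ^ Suc 1 / fact 1)"
        by (intro mult_left_mono Taylor_exp) auto
      also have "\<dots> = exp (l * u - x * cosh u + \<bar>Re h\<bar> * cosh u) * ((norm h)\<^sup>2 * (cosh u)\<^sup>2)"
        by (simp add: abs_mult norm_mult exp_add power2_eq_square)
      also have "\<dots> \<le> exp (l * u - x / 2 * cosh u) * ((norm h)\<^sup>2 * (cosh u)\<^sup>2)"
      proof -
        have "\<bar>Re h\<bar> * cosh u \<le> x / 2 * cosh u"
          using \<open>\<bar>Re h\<bar> < x / 2\<close> by (intro mult_right_mono) auto
        then have "l * u - x * cosh u + \<bar>Re h\<bar> * cosh u \<le> l * u - x / 2 * cosh u" by linarith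
        then show ?thesis by (intro mult_right_mono) auto
      qed
      finally show ?thesis by (simp add: mult_ac)
    qed
    then have "norm (LINT u|lborel. G u) \<le> (LINT u|lborel. (norm h)\<^sup>2 * ((cosh u)\<^sup>2 * exp (l * u - x / 2 * cosh u)))"
      using x by (intro Bochner_Integration.integral_norm_bound_integral intG integrable_mult_right integrable_cosh_sq_exp) auto
    then have "norm (LINT u|lborel. G u) \<le> (norm h)\<^sup>2 * K" by (simp add: K_def)
    moreover have "(LINT u|lborel. G u) = 2 * (besselH l (w + h) - besselH l w + h * ((besselH (l + 1) w + besselH (l - 1) w) / 2))"
      unfolding G_def H using int[OF assms] int[OF wh] by (simp add: algebra_simps add_divide_distrib)
    ultimately have "norm (2 * (besselH l (w + h) - besselH l w + h * ((besselH (l + 1) w + besselH (l - 1) w) / 2))) / (2 * norm h) \<le> (norm h)\<^sup>2 * K / (2 * norm h)"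
      by (intro divide_right_mono) auto
    also have "\<dots> = K / 2 * norm h" using h by (simp add: power2_eq_square)
    also have "norm (2 * (besselH l (w + h) - besselH l w + h * ((besselH (l + 1) w + besselH (l - 1) w) / 2))) / (2 * norm h)
       = norm ((2 * (besselH l (w + h) - besselH l w + h * ((besselH (l + 1) w + besselH (l - 1) w) / 2))) / (2 * h))"
      by (simp add: norm_divide norm_mult)
    also have "(2 * (besselH l (w + h) - besselH l w + h * ((besselH (l + 1) w + besselH (l - 1) w) / 2))) / (2 * h)
       = (besselH l (w + h) - besselH l w) / h - - (besselH (l + 1) w + besselH (l - 1) w) / 2"
      using h by (simp add: field_simps)
    finally show ?thesis .
  qed
  have "((\<lambda>h. (besselH l (w + h) - besselH l w) / h - - (besselH (l + 1) w + besselH (l - 1) w) / 2) \<longlongrightarrow> 0) (at 0)"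
  proof (rule Lim_null_comparison)
    show "\<forall>\<^sub>F h in at 0. norm ((besselH l (w + h) - besselH l w) / h - - (besselH (l + 1) w + besselH (l - 1) w) / 2) \<le> K / 2 * norm h"
      unfolding eventually_at using bound x by (intro exI[of _ "x / 2"]) auto
    show "((\<lambda>h::complex. K / 2 * norm h) \<longlongrightarrow> 0) (at 0)"
      by (auto intro!: tendsto_eq_intros)
  qed
  then show ?thesis unfolding DERIV_def by (rule LIM_zero_cancel)
qed

lemma continuous_on_besselH: "continuous_on {w. Re w > 0} (besselH l)"
  using besselH_has_field_derivative[of _ l]
  by (intro continuous_at_imp_continuous_on ballI) (auto intro: DERIV_isCont)

text \<open>Serves the integer orders, where \<open>besselK\<close> is itself a limit over orders. A
  convergent sequence of orders stays between some \<open>- B\<close> and \<open>B\<close>, so the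
  real integrands for these two orders together dominate.\<close>

lemma tendsto_besselH_order:
  assumes "Re w > 0"
  shows "((\<lambda>s. besselH s w) \<longlongrightarrow> besselH l w) (at l)"
  unfolding tendsto_at_iff_sequentially comp_def
proof (intro allI impI)
  fix X :: "nat \<Rightarrow> real"
  assume X: "X \<longlonglongrightarrow> l"
  then obtain B where B: "B > 0" "\<And>n. \<bar>X n\<bar> \<le> B"
    using convergent_imp_Bseq[of X] by (auto simp: Bseq_def convergent_def)
  have "(\<lambda>n. LINT u|lborel. exp (of_real (X n * u) - w * of_real (cosh u))) \<longlonglongrightarrow>
     (LINT u|lborel. exp (of_real (l * u) - w * of_real (cosh u)))"
  proof (rule integral_dominated_convergence)
    show "integrable lborel (\<lambda>u. exp (B * u - Re w * cosh u) + exp (- B * u - Re w * cosh u))"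
      by (intro Bochner_Integration.integrable_add integrable_exp_cosh assms)
    show "(\<lambda>u. exp (complex_of_real (s * u) - w * of_real (cosh u))) \<in> borel_measurable lborel" for s
      using integrable_exp_cosh_complex[OF assms] by auto
    then show "(\<lambda>u. exp (complex_of_real (s * u) - w * of_real (cosh u))) \<in> borel_measurable lborel" for s .
    show "AE u in lborel. (\<lambda>n. exp (of_real (X n * u) - w * of_real (cosh u))) \<longlonglongrightarrow> exp (of_real (l * u) - w * of_real (cosh u))"
      using X by (intro AE_I2 tendsto_intros)
    show "AE u in lborel. norm (exp (of_real (X n * u) - w * of_real (cosh u))) \<le> exp (B * u - Re w * cosh u) + exp (- B * u - Re w * cosh u)" for n
    proof (rule AE_I2)
      fix u :: real
      have "X n * u \<le> B * \<bar>u\<bar>"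
        using mult_right_mono[OF B(2)[of n], of "\<bar>u\<bar>"] by (metis abs_ge_self abs_ge_zero abs_mult order.trans)
      then have "exp (X n * u - Re w * cosh u) \<le> exp (B * u - Re w * cosh u) \<or> exp (X n * u - Re w * cosh u) \<le> exp (- B * u - Re w * cosh u)"
        by (cases "u \<ge> 0") auto
      then show "norm (exp (of_real (X n * u) - w * of_real (cosh u))) \<le> exp (B * u - Re w * cosh u) + exp (- B * u - Re w * cosh u)"
        unfolding norm_exp_cosh by (smt (verit) exp_gt_zero)
    qed
  qed
  then show "(\<lambda>n. besselH (X n) w) \<longlonglongrightarrow> besselH l w"
    unfolding besselH_def by (intro tendsto_intros) auto
qed

text \<open>Translating \<open>u\<close> by \<open>- ln x\<close> turns \<open>x * cosh u\<close>
  into \<open>exp u / 2 + x\<^sup>2 * exp (- u) / 2\<close> and produces the factor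
  \<open>x powr (- l)\<close>. The second summand fades as \<open>x\<close> tends to 0, and dropping
  it gives both the dominating function and the limiting Gamma integral.\<close>

lemma besselH_scaled_tendsto:
  assumes "l > 0"
  shows "((\<lambda>x. of_real (x powr l) * besselH l (of_real x)) \<longlongrightarrow> of_real (2 powr (l - 1) * Gamma l)) (at_right 0)"
  unfolding tendsto_at_iff_sequentially
proof (intro allI impI)
  fix X :: "nat \<Rightarrow> real"
  assume X: "\<forall>i. X i \<in> {0<..} - {0}" "X \<longlonglongrightarrow> 0"
  let ?g = "\<lambda>x u. exp (l * u - 1 / 2 * exp u - x\<^sup>2 / 2 * exp (- u))"
  have eq: "of_real (x powr l) * besselH l (of_real x) = of_real ((LINT u|lborel. ?g x u) / 2)" if x: "x > 0" for x
  proof -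
    have "besselH l (of_real x) = (LINT u|lborel. of_real (exp (l * u - x * cosh u))) / 2"
      by (simp add: besselH_def exp_of_real[symmetric])
    also have "\<dots> = of_real ((LINT u|lborel. exp (l * u - x * cosh u)) / 2)"
      by (simp del: of_real_exp)
    also have "(LINT u|lborel. exp (l * u - x * cosh u)) = (LINT u|lborel. exp (l * (- ln x + 1 * u) - x * cosh (- ln x + 1 * u)))"
      using lborel_integral_real_affine[of 1 "\<lambda>u. exp (l * u - x * cosh u)" "- ln x"] by simp
    also have "(\<lambda>u. exp (l * (- ln x + 1 * u) - x * cosh (- ln x + 1 * u))) = (\<lambda>u. x powr (- l) * ?g x u)"
      using x by (intro ext) (simp add: powr_def cosh_field_def exp_add exp_diff exp_minus power2_eq_square field_simps flip: exp_add)
    finally show ?thesis using x by (simp add: powr_minus field_simps)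
  qed
  have "(\<lambda>n. LINT u|lborel. ?g (X n) u) \<longlonglongrightarrow> (LINT u|lborel. exp (l * u - 1 / 2 * exp u))"
  proof (rule integral_dominated_convergence)
    show "integrable lborel (\<lambda>u. exp (l * u - 1 / 2 * exp u))"
      using assms by (intro Gamma_integral_exp_substitution_scaled) auto
    show "AE u in lborel. (\<lambda>n. ?g (X n) u) \<longlonglongrightarrow> exp (l * u - 1 / 2 * exp u)"
      using X by (intro AE_I2) (auto intro!: tendsto_eq_intros)
  qed auto
  also have "(LINT u|lborel. exp (l * u - 1 / 2 * exp u)) = Gamma l * 2 powr l"
    using assms by (subst Gamma_integral_exp_substitution_scaled) (auto simp: powr_divide)
  finally have "(\<lambda>n. complex_of_real ((LINT u|lborel. ?g (X n) u) / 2)) \<longlonglongrightarrow> of_real (Gamma l * 2 powr l / 2)"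
    by (intro tendsto_intros) auto
  also have "(\<lambda>n. complex_of_real ((LINT u|lborel. ?g (X n) u) / 2)) = (\<lambda>n. of_real (X n powr l) * besselH l (of_real (X n)))"
    using X by (intro ext eq[symmetric]) auto
  finally show "((\<lambda>x. of_real (x powr l) * besselH l (of_real x)) \<circ> X) \<longlonglongrightarrow> of_real (2 powr (l - 1) * Gamma l)"
    by (simp add: comp_def powr_diff mult.commute)
qed

section \<open>The modified Bessel function of the first kind\<close>

text \<open>The entire factor of \<open>besselI\<close>, as a series in
  \<open>y = (z / 2)\<^sup>2\<close>, separated from the multivalued power of
  \<open>z / 2\<close>.\<close>

definition besselE :: "real \<Rightarrow> complex \<Rightarrow> complex" where
  "besselE l y = (\<Sum>k. rGamma (of_real l + of_nat k + 1) / fact k * y ^ k)"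

lemma besselI_conv_besselE: "besselI l z = (z / 2) powr of_real l * besselE l ((z / 2)\<^sup>2)"
  by (simp add: besselI_def besselE_def power_mult)

text \<open>Ratio test: from \<open>N\<close> on the argument of \<open>rGamma\<close> has norm at
  least 1, so its values do not grow by \<open>rGamma_plus1\<close>, while
  \<open>norm y / (n + 1)\<close> is at most one half.\<close>

lemma summable_besselE: "summable (\<lambda>k. rGamma (of_real l + of_nat k + 1) / fact k * (y::complex) ^ k)"
proof -
  define N where "N = nat \<lceil>max (2 * norm y) (- l)\<rceil>"
  show ?thesis
  proof (rule summable_ratio_test[of "1 / 2" N])
    fix n assume n: "n \<ge> N"
    then have "real n \<ge> max (2 * norm y) (- l)" unfolding N_def by linarith
    then have n': "real n \<ge> 2 * norm y" "l + real n + 1 \<ge> 1" by auto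
    let ?z = "complex_of_real l + of_nat n + 1"
    have "?z = of_real (l + real n + 1)" by simp
    then have "norm ?z \<ge> 1" using n'(2) by (metis abs_ge_self norm_of_real order.trans)
    then have "1 * norm (rGamma (?z + 1)) \<le> norm ?z * norm (rGamma (?z + 1))"
      by (intro mult_right_mono) auto
    also have "\<dots> = norm (rGamma ?z)"
      by (metis norm_mult rGamma_plus1)
    finally have "norm (rGamma (?z + 1)) \<le> norm (rGamma ?z)" by simp
    moreover have "norm y / real (Suc n) \<le> 1 / 2" using n' by (simp add: field_simps)
    ultimately have "norm (rGamma (?z + 1)) * (norm y / real (Suc n)) * (norm y ^ n / fact n)
       \<le> norm (rGamma ?z) * (1 / 2) * (norm y ^ n / fact n)"
      by (intro mult_right_mono mult_mono) auto
    then show "norm (rGamma (of_real l + of_nat (Suc n) + 1) / fact (Suc n) * y ^ Suc n)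
       \<le> 1 / 2 * norm (rGamma (of_real l + of_nat n + 1) / fact n * y ^ n)"
      by (simp add: norm_mult norm_divide norm_power add_ac mult_ac del: of_nat_Suc)
        (simp add: add_ac)
  qed simp
qed

text \<open>The factor \<open>k + 1\<close> from differentiation cancels against the factorial, and
  the index shift raises the order by one.\<close>

lemma diffs_besselE:
  "diffs (\<lambda>k. rGamma (of_real l + of_nat k + 1) / fact k) =
   (\<lambda>k. rGamma (complex_of_real (l + 1) + of_nat k + 1) / fact k)"
  by (intro ext) (simp add: diffs_def field_simps del: of_nat_Suc, simp add: add_ac)

lemma besselE_has_field_derivative: "(besselE l has_field_derivative besselE (l + 1) y) (at y)"
  using termdiffs_strong_converges_everywhere[OF summable_besselE[of l], of y]
  unfolding diffs_besselE besselE_def[symmetric] .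

text \<open>Writing \<open>rGamma (l + k)\<close> as \<open>(l + k) * rGamma (l + k + 1)\<close>
  splits the series in two; the part with factor \<open>k\<close> is \<open>y\<close> times the
  derivative series.\<close>

lemma besselE_recurrence: "besselE (l - 1) y = of_real l * besselE l y + y * besselE (l + 1) y"
proof -
  let ?c = "\<lambda>k. rGamma (complex_of_real l + of_nat k + 1) / fact k"
  have "(\<lambda>k. of_nat k * ?c k * y ^ (k - Suc 0)) sums besselE (l + 1) y"
    using diffs_equiv[of ?c y] summable_besselE[of "l + 1" y] unfolding diffs_besselE besselE_def by blast
  \<comment> \<open>Multiplication by \<open>y\<close> restores the power lost in
    \<open>k - Suc 0\<close>; at \<open>k = 0\<close> the term is 0 either way.\<close>
  from sums_mult[OF this, of y] have "(\<lambda>k. of_nat k * (?c k * y ^ k)) sums (y * besselE (l + 1) y)"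
    by (rule sums_cong[THEN iffD1, rotated]) (case_tac n; simp add: mult_ac)
  moreover have "(\<lambda>k. of_real l * (?c k * y ^ k)) sums (of_real l * besselE l y)"
    using sums_mult[OF summable_sums[OF summable_besselE[of l y]]] unfolding besselE_def .
  ultimately have "(\<lambda>k. of_real l * (?c k * y ^ k) + of_nat k * (?c k * y ^ k)) sums (of_real l * besselE l y + y * besselE (l + 1) y)"
    by (intro sums_add)
  moreover have "of_real l * (?c k * y ^ k) + of_nat k * (?c k * y ^ k) = 
      rGamma (of_real (l - 1) + of_nat k + 1) / fact k * y ^ k" for k
  proof -
    have "of_real l * (?c k * y ^ k) + of_nat k * (?c k * y ^ k) =
      ((of_real l + of_nat k) * rGamma (of_real l + of_nat k + 1)) / fact k * y ^ k"
      by (simp add: algebra_simps add_divide_distrib)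
    then show ?thesis unfolding rGamma_plus1 by simp
  qed
  ultimately show ?thesis
    unfolding besselE_def by (simp only: sums_iff)
qed

lemma besselI_recurrence:
  assumes "z \<noteq> 0"
  shows "besselI (l - 1) z = besselI (l + 1) z + 2 * of_real l / z * besselI l z"
proof -
  have powr: "(z / 2) powr of_real (l - 1) = (z / 2) powr of_real l / (z / 2)"
    "(z / 2) powr of_real (l + 1) = (z / 2) powr of_real l * (z / 2)"
    using assms by (simp_all add: powr_diff powr_add)
  show ?thesis
    unfolding besselI_conv_besselE besselE_recurrence[of l] powr
    using assms by (simp add: field_simps power2_eq_square)
qed

lemma besselI_has_field_derivative:
  assumes "Re z > 0"
  shows "(besselI l has_field_derivative (besselI (l + 1) z + of_real l / z * besselI l z)) (at z)"
proof -
  have z: "z / 2 \<notin> \<real>\<^sub>\<le>\<^sub>0" "z \<noteq> 0" using assms by (auto simp: complex_nonpos_Reals_iff)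
  have powr: "((\<lambda>z. (z / 2) powr of_real l) has_field_derivative (of_real l / z * (z / 2) powr of_real l)) (at z)"
    using z by (auto intro!: derivative_eq_intros simp: powr_diff field_simps)
  have E: "((\<lambda>z. besselE l ((z / 2)\<^sup>2)) has_field_derivative besselE (l + 1) ((z / 2)\<^sup>2) * (z / 2)) (at z)"
    by (rule DERIV_chain2[OF besselE_has_field_derivative])
       (auto intro!: derivative_eq_intros simp: power2_eq_square)
  have 1: "(z / 2) powr of_real (l + 1) = (z / 2) powr of_real l * (z / 2)"
    using z by (simp add: powr_add)
  show ?thesis
    unfolding besselI_conv_besselE 1
    by (rule DERIV_cong[OF DERIV_mult[OF powr E]]) (simp add: algebra_simps)
qed

text \<open>The three-term recurrence converts the raising form into this lowering one. Lowering at
  order \<open>l\<close> and raising at order \<open>l - 1\<close> close into a first-order system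
  for the two functions.\<close>

lemma besselI_has_field_derivative':
  assumes "Re z > 0"
  shows "(besselI l has_field_derivative (besselI (l - 1) z - of_real l / z * besselI l z)) (at z)"
proof -
  have "z \<noteq> 0" using assms by auto
  then show ?thesis
    by (intro DERIV_cong[OF besselI_has_field_derivative[OF assms]]) (simp add: besselI_recurrence)
qed

text \<open>The scaling cancels the power of \<open>x\<close>, leaving the continuous function
  \<open>besselE l\<close>, whose value at 0 is its constant coefficient.\<close>

lemma besselI_scaled_tendsto:
  "((\<lambda>x. of_real (x powr (- l)) * besselI l (of_real x)) \<longlongrightarrow>
     of_real (2 powr (- l)) * rGamma (of_real (l + 1))) (at_right 0)"
proof -
  have "isCont (besselE l) 0" by (rule DERIV_isCont[OF besselE_has_field_derivative])
  then have "((\<lambda>x. besselE l ((complex_of_real x / 2)\<^sup>2)) \<longlongrightarrow> besselE l 0) (at_right 0)"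
    by (rule isCont_tendsto_compose) (auto intro!: tendsto_eq_intros)
  also have "besselE l 0 = rGamma (of_real (l + 1))"
    unfolding besselE_def by (subst powser_zero) simp
  finally have "((\<lambda>x. of_real (2 powr (- l)) * besselE l ((complex_of_real x / 2)\<^sup>2)) \<longlongrightarrow> 
    of_real (2 powr (- l)) * rGamma (of_real (l + 1))) (at_right 0)"
    by (intro tendsto_intros)
  then show ?thesis
  proof (rule Lim_transform_eventually)
    show "\<forall>\<^sub>F x in at_right 0. of_real (2 powr (- l)) * besselE l ((complex_of_real x / 2)\<^sup>2) =
      of_real (x powr (- l)) * besselI l (of_real x)"
      using eventually_at_right_less[of "0::real"]
    proof eventually_elim
      case (elim x)
      have "(complex_of_real x / 2) powr of_real l = of_real ((x / 2) powr l)"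
        using elim by (subst powr_of_real[symmetric]) auto
      also have "(x / 2) powr l = x powr l * 2 powr (- l)"
        using elim by (simp add: powr_divide powr_minus_divide)
      finally show ?case
        using elim by (simp add: besselI_conv_besselE powr_minus)
    qed
  qed
qed

section \<open>Identification of the Bessel functions\<close>

lemma convex_Re_gt_0: "convex {z. Re z > 0}"
  using convex_halfspace_gt[of 0 "1::complex"] by (simp add: inner_complex_def)

text \<open>
  Abel's identity: $(A, B)$ solves the system of $(I_\lambda, I_{\lambda - 1})$, and $(P, -Q)$ solves
  it as well, so that $A Q + B P$ is minus a Wronskian.
\<close>

lemma cross_product_eq_limit:
  fixes A B P Q :: "complex \<Rightarrow> complex"
  assumes A: "\<And>z. Re z > 0 \<Longrightarrow> (A has_field_derivative B z - of_real l / z * A z) (at z)"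
    and B: "\<And>z. Re z > 0 \<Longrightarrow> (B has_field_derivative A z + of_real (l - 1) / z * B z) (at z)"
    and P: "\<And>z. Re z > 0 \<Longrightarrow> (P has_field_derivative - Q z - of_real l / z * P z) (at z)"
    and Q: "\<And>z. Re z > 0 \<Longrightarrow> (Q has_field_derivative - P z + of_real (l - 1) / z * Q z) (at z)"
    and lim: "((\<lambda>x. of_real x * (A (of_real x) * Q (of_real x) + B (of_real x) * P (of_real x))) \<longlongrightarrow> c) (at_right 0)"
    and z: "Re z > 0"
  shows "z * (A z * Q z + B z * P z) = c"
proof -
  let ?W = "\<lambda>z. z * (A z * Q z + B z * P z)"
  \<comment> \<open>By the system the bracket has derivative \<open>- 1 / z\<close> times itself;
    the factor \<open>z\<close> compensates, so \<open>?W\<close> is constant on the convex half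
    plane and the limit at 0 identifies it.\<close>
  have "(?W has_field_derivative 0) (at z within {z. Re z > 0})" if "z \<in> {z. Re z > 0}" for z
  proof -
    have z: "Re z > 0" "z \<noteq> 0" using that by auto
    show ?thesis
      by (rule DERIV_subset[OF DERIV_cong[OF DERIV_mult[OF DERIV_ident
            DERIV_add[OF DERIV_mult[OF A[OF z(1)] Q[OF z(1)]] DERIV_mult[OF B[OF z(1)] P[OF z(1)]]]]]])
         (use z(2) in \<open>auto simp: field_simps\<close>)
  qed
  then obtain k where k: "\<And>z. Re z > 0 \<Longrightarrow> ?W z = k"
    using has_field_derivative_zero_constant[OF convex_Re_gt_0, of ?W] by auto
  have "((\<lambda>x::real. k) \<longlongrightarrow> c) (at_right 0)"
    using lim
  proof (rule Lim_transform_eventually)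
    show "\<forall>\<^sub>F x in at_right 0. of_real x * (A (of_real x) * Q (of_real x) + B (of_real x) * P (of_real x)) = k"
      using eventually_at_right_less[of "0::real"] by eventually_elim (use k in auto)
  qed
  then have "k = c" by (simp add: tendsto_const_iff)
  then show ?thesis using k[OF z] by simp
qed

lemma besselH_derivative_lower:
  assumes "Re z > 0"
  shows "(besselH l has_field_derivative - besselH (l - 1) z - of_real l / z * besselH l z) (at z)"
proof -
  have "z \<noteq> 0" using assms by auto
  then have "of_real l / z * besselH l z = (besselH (l + 1) z - besselH (l - 1) z) / 2"
    using besselH_recurrence[OF assms, of l] by (simp add: field_simps)
  then show ?thesis
    by (intro DERIV_cong[OF besselH_has_field_derivative[OF assms]]) (simp add: field_simps)
qed

text \<open>The lowering form at order \<open>- l\<close>, read through the evenness of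
  \<open>besselH\<close> in the order.\<close>

lemma besselH_derivative_upper:
  assumes "Re z > 0"
  shows "(besselH l has_field_derivative - besselH (l + 1) z + of_real l / z * besselH l z) (at z)"
proof -
  have "besselH (- l) = besselH l" "besselH (- l - 1) z = besselH (l + 1) z"
    using besselH_minus[of l] besselH_minus[of "l + 1" z] by auto
  then show ?thesis using besselH_derivative_lower[OF assms, of "- l"] by simp
qed

text \<open>Near 0 the first product is of size \<open>x powr (2 * l)\<close> and vanishes; the
  second tends to \<open>rGamma l * Gamma l = 1\<close>. Orders between 0 and 1 make the scaled
  limit of \<open>besselH\<close> available at both \<open>l\<close> and
  \<open>1 - l\<close>.\<close>

lemma besselI_besselH_cross:
  assumes l: "0 < l" "l < 1" and z: "Re z > 0"
  shows "z * (besselI l z * besselH (l - 1) z + besselI (l - 1) z * besselH l z) = 1"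
proof (rule cross_product_eq_limit[OF _ _ _ _ _ z])
  show "(besselI l has_field_derivative besselI (l - 1) z - of_real l / z * besselI l z) (at z)" if "Re z > 0" for z
    by (rule besselI_has_field_derivative'[OF that])
  show "(besselI (l - 1) has_field_derivative besselI l z + of_real (l - 1) / z * besselI (l - 1) z) (at z)" if "Re z > 0" for z
    using besselI_has_field_derivative[OF that, of "l - 1"] by simp
  show "(besselH l has_field_derivative - besselH (l - 1) z - of_real l / z * besselH l z) (at z)" if "Re z > 0" for z
    by (rule besselH_derivative_lower[OF that])
  show "(besselH (l - 1) has_field_derivative - besselH l z + of_real (l - 1) / z * besselH (l - 1) z) (at z)" if "Re z > 0" for z
    using besselH_derivative_upper[OF that, of "l - 1"] by simp
  \<comment> \<open>The prefactor \<open>x\<close> is split as \<open>2 * l - l + (1 - l)\<close> in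
    the exponent for the first product and as \<open>(1 - l) + l\<close> for the second.\<close>
  have "((\<lambda>x. of_real (x powr (2 * l)) * (of_real (x powr (- l)) * besselI l (of_real x)) * (of_real (x powr (1 - l)) * besselH (1 - l) (of_real x))
     + (of_real (x powr (- (l - 1))) * besselI (l - 1) (of_real x)) * (of_real (x powr l) * besselH l (of_real x)))
     \<longlongrightarrow> of_real 0 * (of_real (2 powr (- l)) * rGamma (of_real (l + 1))) * of_real (2 powr ((1 - l) - 1) * Gamma (1 - l))
      + (of_real (2 powr (- (l - 1))) * rGamma (of_real (l - 1 + 1))) * of_real (2 powr (l - 1) * Gamma l)) (at_right 0)"
    (is "(?f \<longlongrightarrow> ?L) _")
  proof -
    have "((\<lambda>x. x powr (2 * l)) \<longlongrightarrow> 0) (at_right 0)"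
      using l by real_asymp
    then show ?thesis
      using l by (intro tendsto_add[OF tendsto_mult[OF tendsto_mult[OF tendsto_of_real besselI_scaled_tendsto] besselH_scaled_tendsto]
          tendsto_mult[OF besselI_scaled_tendsto besselH_scaled_tendsto]]) auto
  qed
  also have "?L = 1"
  proof -
    have "2 powr (1 - l) * 2 powr (l - 1) = (1::real)" by (simp flip: powr_add)
    moreover have "rGamma l * Gamma l = 1"
      using Gamma_real_pos[OF l(1)] by (simp add: rGamma_inverse_Gamma)
    moreover have "?L = of_real ((2 powr (1 - l) * 2 powr (l - 1)) * (rGamma l * Gamma l))"
      by (simp add: rGamma_complex_of_real)
    ultimately show ?thesis by simp
  qed
  finally show "((\<lambda>x. of_real x * (besselI l (of_real x) * besselH (l - 1) (of_real x) + besselI (l - 1) (of_real x) * besselH l (of_real x))) \<longlongrightarrow> 1) (at_right 0)"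
  proof (rule Lim_transform_eventually)
    show "\<forall>\<^sub>F x in at_right 0. ?f x = of_real x * (besselI l (of_real x) * besselH (l - 1) (of_real x) + besselI (l - 1) (of_real x) * besselH l (of_real x))"
      using eventually_at_right_less[of "0::real"]
    proof eventually_elim
      case (elim x)
      have 1: "complex_of_real (x powr (2 * l)) * of_real (x powr (- l)) * of_real (x powr (1 - l)) = of_real x"
        "complex_of_real (x powr (- (l - 1))) * of_real (x powr l) = of_real x"
        using elim by (simp_all del: powr_numeral flip: of_real_mult powr_add)
      have 2: "besselH (1 - l) = besselH (l - 1)"
        using besselH_minus[of "l - 1"] by (intro ext) simp
      have "?f x = (of_real (x powr (2 * l)) * of_real (x powr (- l)) * of_real (x powr (1 - l))) * (besselI l (of_real x) * besselH (1 - l) (of_real x))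
         + (of_real (x powr (- (l - 1))) * of_real (x powr l)) * (besselI (l - 1) (of_real x) * besselH l (of_real x))"
        by (simp only: mult_ac)
      then show ?case unfolding 1 2 by (simp add: algebra_simps)
    qed
  qed
qed

text \<open>Orders \<open>- l\<close> and \<open>1 - l\<close>, the latter with a minus sign, solve
  the system required of \<open>P\<close> and \<open>Q\<close>. In the limit only
  \<open>rGamma l * rGamma (1 - l)\<close> survives, and the reflection formula evaluates
  it.\<close>

lemma besselI_cross:
  assumes l: "0 < l" "l < 1" and z: "Re z > 0"
  shows "z * (besselI (l - 1) z * besselI (- l) z - besselI l z * besselI (1 - l) z) = of_real (2 * sin (l * pi) / pi)"
proof -
  have "z * (besselI l z * (- besselI (1 - l) z) + besselI (l - 1) z * besselI (- l) z) = of_real (2 * sin (l * pi) / pi)"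
  proof (rule cross_product_eq_limit[OF _ _ _ _ _ z])
    show "(besselI l has_field_derivative besselI (l - 1) z - of_real l / z * besselI l z) (at z)" if "Re z > 0" for z
      by (rule besselI_has_field_derivative'[OF that])
    show "(besselI (l - 1) has_field_derivative besselI l z + of_real (l - 1) / z * besselI (l - 1) z) (at z)" if "Re z > 0" for z
      using besselI_has_field_derivative[OF that, of "l - 1"] by simp
    show "(besselI (- l) has_field_derivative - (- besselI (1 - l) z) - of_real l / z * besselI (- l) z) (at z)" if "Re z > 0" for z
      using besselI_has_field_derivative[OF that, of "- l"] by (simp add: add.commute)
    show "((\<lambda>z. - besselI (1 - l) z) has_field_derivative - besselI (- l) z + of_real (l - 1) / z * (- besselI (1 - l) z)) (at z)" if "Re z > 0" for z
      using DERIV_minus[OF besselI_has_field_derivative'[OF that, of "1 - l"]]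
      by (rule DERIV_cong) (simp add: field_simps)
    have "((\<lambda>x. of_real (x powr 2) * (of_real (x powr (- l)) * besselI l (of_real x)) * - (of_real (x powr (- (1 - l))) * besselI (1 - l) (of_real x))
       + (of_real (x powr (- (l - 1))) * besselI (l - 1) (of_real x)) * (of_real (x powr (- (- l))) * besselI (- l) (of_real x)))
       \<longlongrightarrow> of_real 0 * (of_real (2 powr (- l)) * rGamma (of_real (l + 1))) * - (of_real (2 powr (- (1 - l))) * rGamma (of_real (1 - l + 1)))
        + (of_real (2 powr (- (l - 1))) * rGamma (of_real (l - 1 + 1))) * (of_real (2 powr (- (- l))) * rGamma (of_real (- l + 1)))) (at_right 0)"
      (is "(?f \<longlongrightarrow> ?L) _")
    proof -
      have "((\<lambda>x::real. x powr 2) \<longlongrightarrow> 0) (at_right 0)"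
        by real_asymp
      then show ?thesis
        by (rule tendsto_add[OF tendsto_mult[OF tendsto_mult[OF tendsto_of_real besselI_scaled_tendsto] tendsto_minus[OF besselI_scaled_tendsto]]
            tendsto_mult[OF besselI_scaled_tendsto besselI_scaled_tendsto]])
    qed
    also have "?L = of_real (2 * sin (l * pi) / pi)"
    proof -
      have "2 powr (1 - l) * 2 powr l = (2::real)" by (simp flip: powr_add)
      then have "complex_of_real (2 powr (1 - l)) * of_real (2 powr l) = 2" by (metis of_real_mult of_real_numeral)
      moreover have "?L = (of_real (2 powr (1 - l)) * of_real (2 powr l)) * (rGamma (of_real l) * rGamma (1 - of_real l))"
        by simp
      ultimately have "?L = 2 * (sin (of_real (pi * l)) / of_real pi)"
        using rGamma_reflection_complex[of "of_real l"] by simp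
      also have "\<dots> = of_real (2 * sin (l * pi) / pi)" by (simp add: mult.commute flip: sin_of_real)
      finally show ?thesis .
    qed
    finally show "((\<lambda>x. of_real x * (besselI l (of_real x) * - besselI (1 - l) (of_real x) + besselI (l - 1) (of_real x) * besselI (- l) (of_real x))) \<longlongrightarrow> of_real (2 * sin (l * pi) / pi)) (at_right 0)"
    proof (rule Lim_transform_eventually)
      show "\<forall>\<^sub>F x in at_right 0. ?f x = of_real x * (besselI l (of_real x) * - besselI (1 - l) (of_real x) + besselI (l - 1) (of_real x) * besselI (- l) (of_real x))"
        using eventually_at_right_less[of "0::real"]
      proof eventually_elim
        case (elim x)
        have 1: "complex_of_real (x powr 2) * of_real (x powr (- l)) * of_real (x powr (- (1 - l))) = of_real x"
          "complex_of_real (x powr (- (l - 1))) * of_real (x powr (- (- l))) = of_real x"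
          using elim by (simp_all del: powr_numeral flip: of_real_mult powr_add)
        have "?f x = - ((of_real (x powr 2) * of_real (x powr (- l)) * of_real (x powr (- (1 - l)))) * (besselI l (of_real x) * besselI (1 - l) (of_real x)))
           + (of_real (x powr (- (l - 1))) * of_real (x powr (- (- l)))) * (besselI (l - 1) (of_real x) * besselI (- l) (of_real x))"
          by (simp only: mult_ac mult_minus_right)
        then show ?case unfolding 1 by (simp add: algebra_simps)
      qed
    qed
  qed
  then show ?thesis by (simp add: algebra_simps)
qed

lemma sin_pi_eq_0_iff: "sin (l * pi) = 0 \<longleftrightarrow> l \<in> \<int>" for l :: real
proof -
  have "sin (l * pi) = 0 \<longleftrightarrow> (\<exists>i::int. l * pi = of_int i * pi)" by (rule sin_zero_iff_int2)
  also have "\<dots> \<longleftrightarrow> l \<in> \<int>" by (auto elim: Ints_cases)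
  finally show ?thesis .
qed

lemma besselK_quot_minus: "besselK_quot (- l) z = besselK_quot l z"
proof -
  have "besselI l z - besselI (- l) z = - (besselI (- l) z - besselI l z)" by simp
  then show ?thesis
    by (simp only: besselK_quot_def minus_minus mult_minus_left mult_minus_right sin_minus of_real_minus minus_divide_divide)
qed

lemma besselK_quot_eq_besselH_base:
  assumes l: "0 < l" "l < 1" and z: "Re z > 0"
  shows "besselK_quot l z = besselH l z"
proof -
  have s: "sin (l * pi) \<noteq> 0"
    using l by (intro less_imp_neq[symmetric] sin_gt_zero) auto
  have 1: "z * (besselI l z * besselH (l - 1) z + besselI (l - 1) z * besselH l z) = 1"
    by (rule besselI_besselH_cross[OF l z])
  have 2: "z * (besselI (1 - l) z * besselH l z + besselI (- l) z * besselH (l - 1) z) = 1"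
    using besselI_besselH_cross[of "1 - l" z] l z besselH_minus[of l] besselH_minus[of "l - 1"] by simp
  \<comment> \<open>The two constants 1 are replaced by the cross products; with these multipliers
    the terms in \<open>besselH (l - 1) z\<close> cancel.\<close>
  have "besselI (- l) z - besselI l z =
     besselI (- l) z * (z * (besselI l z * besselH (l - 1) z + besselI (l - 1) z * besselH l z)) -
     besselI l z * (z * (besselI (1 - l) z * besselH l z + besselI (- l) z * besselH (l - 1) z))"
    unfolding 1 2 by simp
  also have "\<dots> = besselH l z * (z * (besselI (l - 1) z * besselI (- l) z - besselI l z * besselI (1 - l) z))"
    by (simp add: algebra_simps)
  also have "\<dots> = besselH l z * of_real (2 * sin (l * pi) / pi)"
    by (simp only: besselI_cross[OF l z])
  finally show ?thesis
    using s by (simp add: besselK_quot_def field_simps)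
qed

text \<open>The functions of order \<open>l\<close> and of order \<open>- l\<close> obey the same
  recurrence with a minus sign; the sine changes sign between \<open>l\<close> and its neighbours,
  which turns it into a plus.\<close>

lemma besselK_quot_recurrence:
  assumes "z \<noteq> 0" "l \<notin> \<int>"
  shows "besselK_quot (l + 1) z = besselK_quot (l - 1) z + 2 * of_real l / z * besselK_quot l z"
proof -
  have s: "complex_of_real (sin (l * pi)) \<noteq> 0" using sin_pi_eq_0_iff assms by simp
  have 1: "besselI (- (l + 1)) z = besselI (- (l - 1)) z - 2 * of_real l / z * besselI (- l) z"
    using besselI_recurrence[OF assms(1), of "- l"] by simp
  have 2: "besselI (l + 1) z = besselI (l - 1) z - 2 * of_real l / z * besselI l z"
    using besselI_recurrence[OF assms(1), of l] by simp
  have "besselI (- (l + 1)) z - besselI (l + 1) z =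
      (besselI (- (l - 1)) z - besselI (l - 1) z) - 2 * of_real l / z * (besselI (- l) z - besselI l z)"
    unfolding 1 2 by (simp add: right_diff_distrib)
  moreover have "sin ((l + 1) * pi) = - sin (l * pi)" "sin ((l - 1) * pi) = - sin (l * pi)"
    by (simp_all add: algebra_simps sin_diff)
  ultimately show ?thesis
    using s assms(1) unfolding besselK_quot_def
    by (simp) (simp add: field_simps)
qed

text \<open>Induction on the integer part, carrying two consecutive orders as the recurrence
  demands. At the start the order \<open>r - 1\<close> is negative and is reflected to
  \<open>1 - r\<close>.\<close>

lemma besselK_quot_eq_besselH:
  assumes "l > 0" "l \<notin> \<int>" and z: "Re z > 0"
  shows "besselK_quot l z = besselH l z"
proof -
  have z0: "z \<noteq> 0" using z by auto
  have "besselK_quot (r + real n) z = besselH (r + real n) z \<and>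
      besselK_quot (r + real n - 1) z = besselH (r + real n - 1) z" if r: "0 < r" "r < 1" for r n
  proof (induction n)
    case 0
    show ?case
      using besselK_quot_eq_besselH_base[OF r z] besselK_quot_eq_besselH_base[of "1 - r" z] r z
        besselK_quot_minus[of "r - 1" z] besselH_minus[of "r - 1" z] by simp
  next
    case (Suc n)
    have "r + real n \<notin> \<int>"
    proof
      assume "r + real n \<in> \<int>"
      then have "r + real n - real n \<in> \<int>" by (intro Ints_diff) auto
      then show False using r by (auto elim!: Ints_cases)
    qed
    then have "besselK_quot (r + real n + 1) z = besselH (r + real n - 1) z + 2 * of_real (r + real n) / z * besselH (r + real n) z"
      using besselK_quot_recurrence[OF z0] Suc by simp
    also have "\<dots> = besselH (r + real n + 1) z"
      using besselH_recurrence[OF z, of "r + real n"] z0 by (simp add: field_simps)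
    finally show ?case using Suc by (simp add: add_ac)
  qed
  from this[of "frac l" "nat \<lfloor>l\<rfloor>"] show ?thesis
    using assms by (simp add: frac_gt_0_iff frac_lt_1) (simp add: frac_def)
qed

lemma besselK_eq_besselH:
  assumes "l > 0" "Re z > 0"
  shows "besselK l z = besselH l z"
proof (cases "l \<in> \<int>")
  case False
  then show ?thesis using besselK_quot_eq_besselH[OF assms(1) _ assms(2)] by (simp add: besselK_def)
next
  case True
  have "((\<lambda>s. besselK_quot s z) \<longlongrightarrow> besselH l z) (at l)"
    using tendsto_besselH_order[OF assms(2)]
  proof (rule Lim_transform_eventually)
    \<comment> \<open>Distance below 1 from the integer \<open>l\<close> keeps \<open>s\<close> off
      the integers; distance below \<open>l\<close> keeps it positive.\<close>
    have "eventually (\<lambda>s. dist s l < min l 1 \<and> s \<noteq> l) (at l)"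
      unfolding eventually_at using assms(1) by (intro exI[of _ "min l 1"]) auto
    then show "\<forall>\<^sub>F s in at l. besselH s z = besselK_quot s z"
    proof eventually_elim
      case (elim s)
      have "s \<notin> \<int>"
      proof
        assume "s \<in> \<int>"
        then have "s - l \<in> \<int>" using True by simp
        then obtain i where i: "s - l = of_int i" by (elim Ints_cases)
        then have "\<bar>real_of_int i\<bar> < 1" using elim by (simp add: dist_real_def)
        then have "i = 0" by linarith
        then show False using i elim by simp
      qed
      then show ?case using elim assms(2) by (intro besselK_quot_eq_besselH[symmetric]) (auto simp: dist_real_def)
    qed
  qed
  then show ?thesis using True by (simp add: besselK_def tendsto_Lim)
qed

section \<open>The extended confluent hypergeometric function\<close>

text \<open>Powers of \<open>t\<close> are at most 1 on the unit interval, so the terms of the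
  exponential series are dominated by \<open>norm (g t) * norm z ^ m / fact m\<close> and may be
  integrated one by one. Stated over a general field to serve both the real and the complex
  function.\<close>

lemma sums_integral_exp:
  fixes g :: "real \<Rightarrow> 'a :: {real_normed_field, banach, second_countable_topology}"
  assumes g: "set_integrable lborel {0<..<1} g"
  shows "set_integrable lborel {0<..<1} (\<lambda>t. g t * exp (z * of_real t))"
    and "(\<lambda>m. (LINT t:{0<..<1}|lborel. g t * of_real t ^ m) * z ^ m / fact m) sums
      (LINT t:{0<..<1}|lborel. g t * exp (z * of_real t))"
proof -
  \<comment> \<open>Extension by 0 makes the bound on powers of \<open>t\<close> valid on the whole
    line.\<close>
  define h where "h = (\<lambda>t. indicator {0<..<1} t *\<^sub>R g t)"
  have h: "integrable lborel h" using g by (simp add: h_def set_integrable_def)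
  have [measurable]: "h \<in> borel_measurable borel" using h by auto
  define f where "f = (\<lambda>m t. h t * of_real t ^ m * (z ^ m / fact m))"
  have le: "norm (h t * of_real t ^ m) \<le> norm (h t)" for m t
  proof (cases "t \<in> {0<..<1}")
    case True
    then have "norm (h t) * \<bar>t\<bar> ^ m \<le> norm (h t) * 1"
      by (intro mult_left_mono power_le_one) auto
    then show ?thesis by (simp add: norm_mult norm_power)
  qed (simp add: h_def)
  have int: "integrable lborel (\<lambda>t. h t * of_real t ^ m)" for m
    by (rule Bochner_Integration.integrable_bound[OF h]) (use le in auto)
  have intf: "integrable lborel (f m)" for m
    unfolding f_def by (intro integrable_mult_left int)
  have sf: "summable (\<lambda>m. norm (f m t))" for t
  proof (rule summable_comparison_test'[where N = 0])
    show "summable (\<lambda>m. norm (h t) * (norm z ^ m / fact m))"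
      using summable_exp_generic[of "norm z"] by (intro summable_mult) (simp add: divide_inverse mult.commute)
    show "norm (norm (f m t)) \<le> norm (h t) * (norm z ^ m / fact m)" for m
      using mult_right_mono[OF le[of t m], of "norm z ^ m / fact m"]
      by (simp add: f_def norm_mult norm_divide norm_power)
  qed
  have sif: "summable (\<lambda>m. LINT t|lborel. norm (f m t))"
  proof (rule summable_comparison_test'[where N = 0])
    show "summable (\<lambda>m. (LINT t|lborel. norm (h t)) * (norm z ^ m / fact m))"
      using summable_exp_generic[of "norm z"] by (intro summable_mult) (simp add: divide_inverse mult.commute)
    show "norm (LINT t|lborel. norm (f m t)) \<le> (LINT t|lborel. norm (h t)) * (norm z ^ m / fact m)" for m
    proof -
      have "(LINT t|lborel. norm (f m t)) \<le> (LINT t|lborel. norm (h t) * (norm z ^ m / fact m))"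
      proof (intro integral_mono)
        show "norm (f m t) \<le> norm (h t) * (norm z ^ m / fact m)" for t
          using mult_right_mono[OF le[of t m], of "norm z ^ m / fact m"]
          by (simp add: f_def norm_mult norm_divide norm_power)
      qed (use intf h in auto)
      then show ?thesis by simp
    qed
  qed
  have sum_f: "(\<Sum>m. f m t) = h t * exp (z * of_real t)" for t
  proof -
    have "(\<lambda>m. h t * ((z * of_real t) ^ m /\<^sub>R fact m)) sums (h t * exp (z * of_real t))"
      by (intro sums_mult exp_converges)
    moreover have "h t * ((z * of_real t) ^ m /\<^sub>R fact m) = f m t" for m
      by (simp add: f_def power_mult_distrib scaleR_conv_of_real field_simps)
    ultimately show ?thesis by (simp add: sums_iff)
  qed
  have h_conv: "h t * c = indicator {0<..<1} t *\<^sub>R (g t * c)" for t c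
    by (simp add: h_def)
  show "set_integrable lborel {0<..<1} (\<lambda>t. g t * exp (z * of_real t))"
    using integrable_suminf[OF intf AE_I2[OF sf] sif] unfolding sum_f h_conv set_integrable_def .
  have "(\<lambda>m. LINT t|lborel. f m t) sums (LINT t|lborel. h t * exp (z * of_real t))"
    using sums_integral[OF intf AE_I2[OF sf] sif] unfolding sum_f .
  moreover have "(LINT t|lborel. f m t) = (LINT t:{0<..<1}|lborel. g t * of_real t ^ m) * z ^ m / fact m" for m
  proof -
    have "(LINT t|lborel. f m t) = (LINT t|lborel. h t * of_real t ^ m) * (z ^ m / fact m)"
      unfolding f_def by simp
    then show ?thesis by (simp add: h_conv set_lebesgue_integral_def)
  qed
  ultimately show "(\<lambda>m. (LINT t:{0<..<1}|lborel. g t * of_real t ^ m) * z ^ m / fact m) sums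
      (LINT t:{0<..<1}|lborel. g t * exp (z * of_real t))"
    by (simp add: h_conv set_lebesgue_integral_def)
qed

section \<open>Euler's integral for the ordinary confluent hypergeometric function\<close>

lemma Beta_lebesgue_integral:
  assumes "a > (0::real)" "b > 0"
  shows "set_integrable lborel {0<..<1} (\<lambda>t. t powr (a - 1) * (1 - t) powr (b - 1))"
    and "(LINT t:{0<..<1}|lborel. t powr (a - 1) * (1 - t) powr (b - 1)) = Beta a b"
proof -
  have "((\<lambda>t. t powr (a - 1) * (1 - t) powr (b - 1)) has_integral Beta a b) {0<..<1}"
    using has_integral_Beta_real[OF assms] by (simp add: has_integral_Icc_iff_Ioo)
  from set_integral_lborel_of_has_integral_nonneg[OF this]
  show "set_integrable lborel {0<..<1} (\<lambda>t. t powr (a - 1) * (1 - t) powr (b - 1))"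
    and "(LINT t:{0<..<1}|lborel. t powr (a - 1) * (1 - t) powr (b - 1)) = Beta a b"
    by auto
qed

lemma Beta_real_pos: "a > 0 \<Longrightarrow> b > 0 \<Longrightarrow> Beta a b > (0::real)"
  by (auto simp: Beta_def intro!: divide_pos_pos mult_pos_pos Gamma_real_pos)

text \<open>Identifies the moments of the Beta density with the coefficients of
  \<open>conf_hyp\<close>.\<close>

lemma Beta_plus_nat_left:
  assumes "a > (0::real)" "b > 0"
  shows "Beta (a + real m) b = Beta a b * (pochhammer a m / pochhammer (a + b) m)"
proof -
  have "a \<notin> \<int>\<^sub>\<le>\<^sub>0" "a + b \<notin> \<int>\<^sub>\<le>\<^sub>0" using assms by (auto simp: nonpos_Ints_def)
  moreover have "Gamma a > 0" "Gamma b > 0" "Gamma (a + b) > 0" "Gamma (a + b + real m) > 0"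
    using assms by (auto intro!: Gamma_real_pos)
  ultimately show ?thesis
    by (simp add: pochhammer_Gamma Beta_def field_simps)
qed

lemma conf_hyp_integral:
  assumes "a > (0::real)" "b > 0"
  shows "Beta a b * conf_hyp a (a + b) x = (LINT t:{0<..<1}|lborel. t powr (a - 1) * (1 - t) powr (b - 1) * exp (x * t))"
proof -
  have "(LINT t:{0<..<1}|lborel. t powr (a - 1) * (1 - t) powr (b - 1) * t ^ m) = Beta a b * (pochhammer a m / pochhammer (a + b) m)" for m
  proof -
    have "(LINT t:{0<..<1}|lborel. t powr (a - 1) * (1 - t) powr (b - 1) * t ^ m) =
        (LINT t:{0<..<1}|lborel. t powr (a + real m - 1) * (1 - t) powr (b - 1))"
    proof (intro set_lebesgue_integral_cong allI impI)
      fix t :: real assume t: "t \<in> {0<..<1}"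
      then have "t powr (a + real m - 1) = t powr (a - 1) * t ^ m"
        by (simp add: add_diff_eq[symmetric] powr_add powr_diff powr_realpow)
      then show "t powr (a - 1) * (1 - t) powr (b - 1) * t ^ m = t powr (a + real m - 1) * (1 - t) powr (b - 1)"
        by simp
    qed auto
    then show ?thesis using Beta_lebesgue_integral(2)[of "a + real m" b] Beta_plus_nat_left[OF assms] assms by simp
  qed
  moreover have "(\<lambda>m. (LINT t:{0<..<1}|lborel. t powr (a - 1) * (1 - t) powr (b - 1) * t ^ m) * x ^ m / fact m) sums
      (LINT t:{0<..<1}|lborel. t powr (a - 1) * (1 - t) powr (b - 1) * exp (x * t))"
    using sums_integral_exp(2)[OF Beta_lebesgue_integral(1)[OF assms], of x] by simp
  ultimately have "(\<lambda>m. Beta a b * (pochhammer a m / pochhammer (a + b) m * x ^ m / fact m)) sums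
      (LINT t:{0<..<1}|lborel. t powr (a - 1) * (1 - t) powr (b - 1) * exp (x * t))"
    by (simp add: mult.assoc)
  moreover have "Beta a b \<noteq> 0"
    using Beta_real_pos[OF assms] by simp
  ultimately have "(\<lambda>m. pochhammer a m / pochhammer (a + b) m * x ^ m / fact m) sums
      ((LINT t:{0<..<1}|lborel. t powr (a - 1) * (1 - t) powr (b - 1) * exp (x * t)) / Beta a b)"
    by (rule sums_mult_D)
  then show ?thesis
    using \<open>Beta a b \<noteq> 0\<close> by (simp add: conf_hyp_def sums_iff)
qed

text \<open>The integrand of \<open>ext_Beta\<close> at real parameters, isolated because
  \<open>t ^ m\<close> in the series and \<open>exp (z * t)\<close> in its sum multiply the same
  kernel.\<close>

definition ext_kernel :: "complex \<Rightarrow> real \<Rightarrow> real \<Rightarrow> real \<Rightarrow> real \<Rightarrow> complex" where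
  "ext_kernel p \<nu> b d t = of_real t powr (of_real b - 3 / 2) * of_real (1 - t) powr (of_real d - 3 / 2) *
     besselK (\<nu> + 1 / 2) (p / of_real (t * (1 - t)))"

text \<open>Continuity comes from \<open>besselH\<close>, which agrees with \<open>besselK\<close>
  at the arguments that occur: division by \<open>t * (1 - t) > 0\<close> keeps the real part
  positive.\<close>

lemma ext_kernel_measurable:
  assumes "Re p > 0" "\<nu> > 0"
  shows "set_borel_measurable borel {0<..<1} (ext_kernel p \<nu> b d)"
proof -
  have pos: "t * (1 - t) > 0" if "t \<in> {0<..<1}" for t :: real using that by simp
  have "continuous_on {0<..<1} (\<lambda>t. besselH (\<nu> + 1 / 2) (p / of_real (t * (1 - t))))"
    by (rule continuous_on_compose2[OF continuous_on_besselH])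
       (use assms in \<open>auto intro!: continuous_intros simp: Re_divide_of_real simp del: of_real_mult of_real_diff\<close>)
  then have "continuous_on {0<..<1} (\<lambda>t. besselK (\<nu> + 1 / 2) (p / of_real (t * (1 - t))))"
    by (rule continuous_on_eq)
       (use assms in \<open>auto simp: besselK_eq_besselH Re_divide_of_real simp del: of_real_mult of_real_diff\<close>)
  then have "continuous_on {0<..<1} (ext_kernel p \<nu> b d)"
    unfolding ext_kernel_def by (intro continuous_intros) auto
  then show ?thesis
    by (rule borel_measurable_continuous_on_indicator[folded set_borel_measurable_def, rotated]) auto
qed

text \<open>The Bessel bound contributes \<open>t * (1 - t)\<close> to the power
  \<open>\<nu> + 1 / 2\<close>; together with the exponent \<open>- 3 / 2\<close> this gives
  \<open>\<nu> - 1\<close>, a Beta integrand with both parameters shifted by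
  \<open>\<nu>\<close>.\<close>

lemma norm_ext_kernel_less:
  assumes "Re p > 0" "\<nu> > 0" "t \<in> {0<..<1}"
  shows "norm (ext_kernel p \<nu> b d t) <
    Gamma (\<nu> + 1 / 2) / 2 * (2 / Re p) powr (\<nu> + 1 / 2) * (t powr (b + \<nu> - 1) * (1 - t) powr (d + \<nu> - 1))"
proof -
  let ?l = "\<nu> + 1 / 2"
  have t: "0 < t" "t < 1" "t * (1 - t) > 0" using assms by auto
  have Re: "Re (p / of_real (t * (1 - t))) = Re p / (t * (1 - t))" by (simp only: Re_divide_of_real)
  then have pos: "Re (p / of_real (t * (1 - t))) > 0" using t assms by simp
  have "norm (besselK ?l (p / of_real (t * (1 - t)))) < Gamma ?l / 2 * (2 / (Re p / (t * (1 - t)))) powr ?l"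
    using norm_besselH_less[OF pos, of ?l] assms unfolding Re
    by (simp only: besselK_eq_besselH[OF _ pos])
  also have "2 / (Re p / (t * (1 - t))) = 2 / Re p * (t * (1 - t))" using t by simp
  also have "\<dots> powr ?l = (2 / Re p) powr ?l * (t powr ?l * (1 - t) powr ?l)"
    using t assms by (simp only: powr_mult)
  finally have K: "norm (besselK ?l (p / of_real (t * (1 - t)))) < Gamma ?l / 2 * ((2 / Re p) powr ?l * (t powr ?l * (1 - t) powr ?l))" .
  have n: "norm (complex_of_real s powr (of_real b - 3 / 2)) = s powr (b - 3 / 2)" if "s > 0" for s b
  proof -
    have "complex_of_real s powr (of_real b - 3 / 2) = of_real (s powr (b - 3 / 2))"
      using that by (subst powr_of_real[symmetric]) auto
    then show ?thesis by simp
  qed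
  have "norm (ext_kernel p \<nu> b d t) = t powr (b - 3 / 2) * (1 - t) powr (d - 3 / 2) * norm (besselK ?l (p / of_real (t * (1 - t))))"
    using n[of t b] n[of "1 - t" d] t unfolding ext_kernel_def norm_mult by simp
  also have "\<dots> < t powr (b - 3 / 2) * (1 - t) powr (d - 3 / 2) * (Gamma ?l / 2 * ((2 / Re p) powr ?l * (t powr ?l * (1 - t) powr ?l)))"
    using K t by (intro mult_strict_left_mono) auto
  also have "\<dots> = Gamma ?l / 2 * (2 / Re p) powr ?l * ((t powr (b - 3 / 2) * t powr ?l) * ((1 - t) powr (d - 3 / 2) * (1 - t) powr ?l))"
    by (simp only: mult_ac)
  also have "t powr (b - 3 / 2) * t powr ?l = t powr (b + \<nu> - 1)"
    by (simp flip: powr_add)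
  also have "(1 - t) powr (d - 3 / 2) * (1 - t) powr ?l = (1 - t) powr (d + \<nu> - 1)"
    by (simp flip: powr_add)
  finally show ?thesis .
qed

lemma set_integrable_ext_kernel:
  assumes "Re p > 0" "\<nu> > 0" "b > 0" "d > 0"
  shows "set_integrable lborel {0<..<1} (ext_kernel p \<nu> b d)"
proof -
  let ?K = "Gamma (\<nu> + 1 / 2) / 2 * (2 / Re p) powr (\<nu> + 1 / 2)"
  have "set_integrable lborel {0<..<1} (\<lambda>t. ?K * (t powr (b + \<nu> - 1) * (1 - t) powr (d + \<nu> - 1)))"
    using Beta_lebesgue_integral(1)[of "b + \<nu>" "d + \<nu>"] assms by (intro set_integrable_mult_right) auto
  then show ?thesis
  proof (rule set_integrable_bound)
    show "set_borel_measurable lborel {0<..<1} (ext_kernel p \<nu> b d)"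
      using ext_kernel_measurable[OF assms(1,2)] by (simp add: set_borel_measurable_def)
    show "AE t in lborel. t \<in> {0<..<1} \<longrightarrow> norm (ext_kernel p \<nu> b d t) \<le> norm (?K * (t powr (b + \<nu> - 1) * (1 - t) powr (d + \<nu> - 1)))"
      using norm_ext_kernel_less[OF assms(1,2)] unfolding real_norm_def
      by (intro AE_I2 impI order.trans[OF less_imp_le abs_ge_self]) blast
  qed
qed

lemma ext_Beta_add_nat:
  "ext_Beta p \<nu> (of_real b + of_nat m) (of_real d) =
     csqrt (2 * p / of_real pi) * (LINT t:{0<..<1}|lborel. ext_kernel p \<nu> b d t * of_real t ^ m)"
proof -
  have "complex_of_real t powr (of_real b + of_nat m - 3 / 2) = of_real t powr (of_real b - 3 / 2) * of_real t ^ m" if "t > 0" for t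
  proof -
    have "complex_of_real t powr (of_real b + of_nat m - 3 / 2) = of_real t powr ((of_real b - 3 / 2) + of_nat m)"
      by (simp add: algebra_simps)
    also have "\<dots> = of_real t powr (of_real b - 3 / 2) * of_real t ^ m"
      using that by (subst powr_add) (simp add: powr_nat')
    finally show ?thesis .
  qed
  then show ?thesis
    unfolding ext_Beta_def
    by (intro arg_cong2[where f = "(*)"] refl set_lebesgue_integral_cong) (auto simp: ext_kernel_def)
qed

lemma ext_conf_hyp_integral:
  assumes "Re p > 0" "\<nu> > 0" "b > 0" "d > 0"
  shows "ext_conf_hyp p \<nu> (of_real b) (of_real (b + d)) z =
    csqrt (2 * p / of_real pi) / of_real (Beta b d) * (LINT t:{0<..<1}|lborel. ext_kernel p \<nu> b d t * exp (z * of_real t))"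
proof -
  have "(\<lambda>m. csqrt (2 * p / of_real pi) / of_real (Beta b d) * ((LINT t:{0<..<1}|lborel. ext_kernel p \<nu> b d t * of_real t ^ m) * z ^ m / fact m))
     sums (csqrt (2 * p / of_real pi) / of_real (Beta b d) * (LINT t:{0<..<1}|lborel. ext_kernel p \<nu> b d t * exp (z * of_real t)))"
    by (intro sums_mult sums_integral_exp(2) set_integrable_ext_kernel assms)
  moreover have "ext_Beta p \<nu> (of_real b + of_nat m) (of_real (b + d) - of_real b) / Beta (of_real b) (of_real (b + d) - of_real b) * z ^ m / fact m =
     csqrt (2 * p / of_real pi) / of_real (Beta b d) * ((LINT t:{0<..<1}|lborel. ext_kernel p \<nu> b d t * of_real t ^ m) * z ^ m / fact m)" for m
    by (simp add: ext_Beta_add_nat Beta_complex_of_real)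
  ultimately show ?thesis
    unfolding ext_conf_hyp_def by (simp only: sums_iff)
qed

section \<open>Comparison with the ordinary function and the final constant\<close>

lemma norm_powr_of_real: "z \<noteq> 0 \<Longrightarrow> norm ((z::complex) powr of_real a) = norm z powr a"
  by (simp add: powr_def)

text \<open>The kernel bound is multiplied by \<open>exp (Re z * t)\<close>, the norm of
  \<open>exp (z * t)\<close>, and integrated; Euler's integral with shifted parameters evaluates the
  majorant.\<close>

lemma norm_ext_conf_hyp_less:
  assumes "Re p > 0" "\<nu> > 0" "b > 0" "d > 0"
  shows "norm (ext_conf_hyp p \<nu> (of_real b) (of_real (b + d)) z) <
    sqrt (2 * norm p / pi) * (Gamma (\<nu> + 1 / 2) / 2 * (2 / Re p) powr (\<nu> + 1 / 2)) *
    (Beta (b + \<nu>) (d + \<nu>) / Beta b d) * conf_hyp (b + \<nu>) (b + d + 2 * \<nu>) (Re z)"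
proof -
  let ?K = "Gamma (\<nu> + 1 / 2) / 2 * (2 / Re p) powr (\<nu> + 1 / 2)"
  let ?S = "\<lambda>t. t powr (b + \<nu> - 1) * (1 - t) powr (d + \<nu> - 1)"
  have B: "Beta b d > 0" using assms by (intro Beta_real_pos)
  have nu: "b + \<nu> > 0" "d + \<nu> > 0" using assms by auto
  have int: "set_integrable lborel {0<..<1} (\<lambda>t. ext_kernel p \<nu> b d t * exp (z * of_real t))"
    by (intro sums_integral_exp(1) set_integrable_ext_kernel assms)
  have intS: "set_integrable lborel {0<..<1} (\<lambda>t. ?S t * exp (Re z * t))"
    using sums_integral_exp(1)[OF Beta_lebesgue_integral(1)[OF nu], of "Re z"] by simp
  have "norm (LINT t:{0<..<1}|lborel. ext_kernel p \<nu> b d t * exp (z * of_real t)) \<le>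
     (LINT t:{0<..<1}|lborel. norm (ext_kernel p \<nu> b d t * exp (z * of_real t)))"
    by (rule set_integral_norm_bound[OF int])
  also have "\<dots> < (LINT t:{0<..<1}|lborel. ?K * (?S t * exp (Re z * t)))"
  proof -
    have less: "norm (ext_kernel p \<nu> b d t * exp (z * of_real t)) < ?K * (?S t * exp (Re z * t))" if "t \<in> {0<..<1}" for t
      using mult_strict_right_mono[OF norm_ext_kernel_less[OF assms(1,2) that, of b d], of "exp (Re z * t)"]
      by (simp add: norm_mult mult.assoc)
    show ?thesis
      unfolding set_lebesgue_integral_def
    proof (rule integral_strict_mono_lborel[where a = 0 and b = 1])
      show "integrable lborel (\<lambda>t. indicator {0<..<1} t *\<^sub>R norm (ext_kernel p \<nu> b d t * exp (z * of_real t)))"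
        using set_integrable_norm[OF int] by (simp add: set_integrable_def)
      show "integrable lborel (\<lambda>t. indicator {0<..<1} t *\<^sub>R (?K * (?S t * exp (Re z * t))))"
        using set_integrable_mult_right[OF intS, of ?K] unfolding set_integrable_def by simp
    qed (use less in \<open>auto simp: indicator_def less_imp_le\<close>)
  qed
  also have "\<dots> = ?K * (Beta (b + \<nu>) (d + \<nu>) * conf_hyp (b + \<nu>) (b + d + 2 * \<nu>) (Re z))"
  proof -
    have "b + \<nu> + (d + \<nu>) = b + d + 2 * \<nu>" by simp
    then show ?thesis
      using conf_hyp_integral[OF nu, of "Re z"] by (simp only: set_integral_mult_right)
  qed
  finally have *: "norm (LINT t:{0<..<1}|lborel. ext_kernel p \<nu> b d t * exp (z * of_real t)) < 
      ?K * (Beta (b + \<nu>) (d + \<nu>) * conf_hyp (b + \<nu>) (b + d + 2 * \<nu>) (Re z))" .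
  have "sqrt (2 * norm p / pi) / Beta b d > 0" using B assms by (auto intro!: divide_pos_pos)
  from mult_strict_left_mono[OF * this]
  show ?thesis
    using B by (simp add: ext_conf_hyp_integral[OF assms] norm_mult norm_divide norm_csqrt mult_ac del: of_real_add)
qed

text \<open>After cancellation this is \<open>Re p \<le> norm p\<close> raised to the power
  \<open>\<nu> + 1 / 2\<close>.\<close>

lemma ext_conf_hyp_constant_le:
  assumes "Re p > 0" "\<nu> > 0"
  shows "sqrt (2 * norm p / pi) * (Gamma (\<nu> + 1 / 2) / 2 * (2 / Re p) powr (\<nu> + 1 / 2)) \<le>
    2 powr \<nu> * norm p powr (\<nu> + 1) * Gamma (\<nu> + 1 / 2) / (sqrt pi * Re p powr (2 * \<nu> + 1))"
proof -
  have p: "norm p > 0" "Re p \<le> norm p" using assms complex_Re_le_cmod[of p] by auto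
  have "Re p powr (\<nu> + 1 / 2) * norm p powr (1 / 2) \<le> norm p powr (\<nu> + 1 / 2) * norm p powr (1 / 2)"
    using p assms by (intro mult_right_mono powr_mono2) auto
  also have "\<dots> = norm p powr (\<nu> + 1)" by (simp add: add.commute flip: powr_add)
  finally have 1: "Re p powr (\<nu> + 1 / 2) * norm p powr (1 / 2) \<le> norm p powr (\<nu> + 1)" .
  have 2: "Re p powr (2 * \<nu> + 1) = Re p powr (\<nu> + 1 / 2) * Re p powr (\<nu> + 1 / 2)"
    by (simp flip: powr_add)
  \<comment> \<open>Here \<open>s\<close> is \<open>sqrt 2\<close>: one copy comes from
    \<open>sqrt (2 * norm p / pi)\<close>, the other from 2 to the power
    \<open>\<nu> + 1 / 2\<close>, and together they cancel the denominator of
    \<open>G / 2\<close>.\<close>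
  have 3: "s * P / Q * (G / 2 * (A * s / R)) = A * G / Q * (P / R)" if "s * s = 2" for s P Q G A R :: real
  proof -
    have "s * P / Q * (G / 2 * (A * s / R)) = (s * s) * (P / Q * (G / 2 * (A / R)))" by (simp add: mult_ac)
    then show ?thesis unfolding that by (simp add: mult_ac)
  qed
  have "sqrt (2 * norm p / pi) = sqrt 2 * norm p powr (1 / 2) / sqrt pi"
    by (simp add: real_sqrt_mult real_sqrt_divide powr_half_sqrt)
  moreover have "(2 / Re p) powr (\<nu> + 1 / 2) = 2 powr \<nu> * sqrt 2 / Re p powr (\<nu> + 1 / 2)"
    using assms by (simp add: powr_divide powr_add powr_half_sqrt)
  ultimately have "sqrt (2 * norm p / pi) * (Gamma (\<nu> + 1 / 2) / 2 * (2 / Re p) powr (\<nu> + 1 / 2)) =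
     2 powr \<nu> * Gamma (\<nu> + 1 / 2) / sqrt pi * (norm p powr (1 / 2) / Re p powr (\<nu> + 1 / 2))"
    by (simp only: 3 real_sqrt_mult_self abs_numeral)
  also have "norm p powr (1 / 2) / Re p powr (\<nu> + 1 / 2) \<le> norm p powr (\<nu> + 1) / Re p powr (2 * \<nu> + 1)"
    unfolding 2 using 1 assms by (simp add: field_simps)
  then have "2 powr \<nu> * Gamma (\<nu> + 1 / 2) / sqrt pi * (norm p powr (1 / 2) / Re p powr (\<nu> + 1 / 2)) \<le>
    2 powr \<nu> * Gamma (\<nu> + 1 / 2) / sqrt pi * (norm p powr (\<nu> + 1) / Re p powr (2 * \<nu> + 1))"
    using assms by (intro mult_left_mono divide_nonneg_pos mult_nonneg_nonneg less_imp_le[OF Gamma_real_pos]) auto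
  finally show ?thesis by (simp add: mult_ac)
qed

theorem theorem6:
  fixes p z :: complex and \<nu> \<kappa> \<mu> :: real
  assumes "Re p > 0"
    and "\<nu> > 0"
    and "\<mu> + \<kappa> + 1 / 2 > 0"
    and "\<mu> - \<kappa> + 1 / 2 > 0"
    and "z \<noteq> 0"
  shows "cmod (ext_Whittaker_M p \<nu> (of_real \<kappa>) (of_real \<mu>) z) <
    (2 powr \<nu> * cmod p powr (\<nu> + 1) * Gamma (\<nu> + 1 / 2) / (sqrt pi * Re p powr (2 * \<nu> + 1))) *
    cmod z powr (\<mu> + 1 / 2) * exp (- Re z / 2) *
    (Beta (\<mu> - \<kappa> + \<nu> + 1 / 2) (\<mu> + \<kappa> + \<nu> + 1 / 2) / Beta (\<mu> - \<kappa> + 1 / 2) (\<mu> + \<kappa> + 1 / 2)) *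
    conf_hyp (\<mu> - \<kappa> + \<nu> + 1 / 2) (2 * \<mu> + 2 * \<nu> + 1) (Re z)"
proof -
  define b d where "b = \<mu> - \<kappa> + 1 / 2" and "d = \<mu> + \<kappa> + 1 / 2"
  define C where "C = 2 powr \<nu> * cmod p powr (\<nu> + 1) * Gamma (\<nu> + 1 / 2) / (sqrt pi * Re p powr (2 * \<nu> + 1))"
  define C' where "C' = sqrt (2 * norm p / pi) * (Gamma (\<nu> + 1 / 2) / 2 * (2 / Re p) powr (\<nu> + 1 / 2))"
  define R where "R = Beta (b + \<nu>) (d + \<nu>) / Beta b d * conf_hyp (b + \<nu>) (b + d + 2 * \<nu>) (Re z)"
  have pos: "b > 0" "d > 0" using assms by (auto simp: b_def d_def)
  have params: "\<mu> - \<kappa> + \<nu> + 1 / 2 = b + \<nu>" "\<mu> + \<kappa> + \<nu> + 1 / 2 = d + \<nu>" "2 * \<mu> + 2 * \<nu> + 1 = b + d + 2 * \<nu>"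
    "\<mu> - \<kappa> + 1 / 2 = b" "\<mu> + \<kappa> + 1 / 2 = d"
    by (simp_all add: b_def d_def)
  have cparams: "of_real \<mu> - of_real \<kappa> + 1 / 2 = complex_of_real b" "2 * of_real \<mu> + 1 = complex_of_real (b + d)"
    "of_real \<mu> + 1 / 2 = complex_of_real (\<mu> + 1 / 2)"
    by (simp_all add: b_def d_def)
  have less: "norm (ext_conf_hyp p \<nu> (of_real b) (of_real (b + d)) z) < C' * R"
    using norm_ext_conf_hyp_less[OF assms(1,2) pos, of z] by (simp add: C'_def R_def mult.assoc)
  have "C' \<ge> 0" using assms by (auto simp: C'_def intro!: mult_nonneg_nonneg less_imp_le[OF Gamma_real_pos])
  \<comment> \<open>Positivity of \<open>R\<close>, needed to enlarge the constant, is read off the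
    strict bound itself, so the sign of \<open>conf_hyp\<close> is never examined directly.\<close>
  moreover have "0 < C' * R" using norm_ge_zero less by (rule le_less_trans)
  ultimately have "R > 0" by (simp add: zero_less_mult_iff)
  then have "C' * R \<le> C * R"
    using ext_conf_hyp_constant_le[OF assms(1,2)] by (intro mult_right_mono) (auto simp: C_def C'_def)
  with less have less': "norm (ext_conf_hyp p \<nu> (of_real b) (of_real (b + d)) z) < C * R" by linarith
  have "norm (z powr (of_real (\<mu> + 1 / 2)) * exp (- z / 2)) = cmod z powr (\<mu> + 1 / 2) * exp (- Re z / 2)"
    unfolding norm_mult norm_powr_of_real[OF assms(5)] by simp
  moreover have "cmod z powr (\<mu> + 1 / 2) * exp (- Re z / 2) > 0" using assms by simp
  ultimately have "cmod (ext_Whittaker_M p \<nu> (of_real \<kappa>) (of_real \<mu>) z) < cmod z powr (\<mu> + 1 / 2) * exp (- Re z / 2) * (C * R)"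
    unfolding ext_Whittaker_M_def cparams norm_mult[of "_ * _" "ext_conf_hyp _ _ _ _ _"]
    using less' by (simp only: mult_strict_left_mono)
  then show ?thesis
    unfolding params C_def[symmetric] by (simp add: R_def mult_ac)
qed

end
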